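(* For every $\gamma>0$ and every graph $H$ with chromatic number $r$ there is $n_0\in\mathbb{N}$ such that for every $n>n_0$, $$\mathrm{IR}(H, K_{1,n}) \leq (r-1)^2 n + \gamma n.$$
   Context: All graphs are finite and simple. $K_{1,n}$ denotes the star with $n$ edges. For graphs $F$, $H$, $G$, write $F \overset{\text{ind}}{\longrightarrow} (H,G)$ if for every coloring of the edges of $F$ with red and blue there is either a red induced copy of $H$ (a vertex set $S\subseteq V(F)$ with $F[S]\cong H$ and all edges of $F[S]$ red) or a blue induced copy of $G$ (defined analogously with blue). The induced Ramsey number $\mathrm{IR}(H,G)$ is the smallest number of vertices of a graph $F$ with $F \overset{\text{ind}}{\longrightarrow} (H,G)$. *)

theory Defs
  imports Main "HOL-Library.Extended_Nat"
begin

type_synonym 'a graph = "'a set \<times> 'a set set"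

definition is_graph :: "'a graph \<Rightarrow> bool" where
  "is_graph G \<longleftrightarrow> finite (fst G) \<and> (\<forall>e\<in>snd G. e \<subseteq> fst G \<and> card e = 2)"

definition chromatic_number :: "'a graph \<Rightarrow> nat" where
  "chromatic_number G = (LEAST k. \<exists>c :: 'a \<Rightarrow> nat.
      (\<forall>v\<in>fst G. c v < k) \<and> (\<forall>u v. {u, v} \<in> snd G \<longrightarrow> c u \<noteq> c v))"

definition star :: "nat \<Rightarrow> nat graph" where
  "star n = ({0..n}, {{0, i} | i. i \<in> {1..n}})"

definition induces_copy :: "'b graph \<Rightarrow> 'b set \<Rightarrow> 'a graph \<Rightarrow> bool" where
  "induces_copy F S H \<longleftrightarrow> S \<subseteq> fst F \<and>
     (\<exists>f. bij_betw f (fst H) S \<and>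
        (\<forall>u\<in>fst H. \<forall>v\<in>fst H. ({u, v} \<in> snd H \<longleftrightarrow> {f u, f v} \<in> snd F)))"

text \<open>A red/blue colouring of the edges of F is a map col : edges -> bool,
  True = red, False = blue. A monochromatic induced copy in colour b.\<close>
definition mono_induced_copy :: "'b graph \<Rightarrow> ('b set \<Rightarrow> bool) \<Rightarrow> bool \<Rightarrow> 'a graph \<Rightarrow> bool" where
  "mono_induced_copy F col b H \<longleftrightarrow>
     (\<exists>S. induces_copy F S H \<and> (\<forall>e\<in>snd F. e \<subseteq> S \<longrightarrow> col e = b))"

definition ind_arrows :: "'b graph \<Rightarrow> 'a graph \<Rightarrow> 'c graph \<Rightarrow> bool" where
  "ind_arrows F H G \<longleftrightarrow>
     (\<forall>col :: 'b set \<Rightarrow> bool. mono_induced_copy F col True H \<or> mono_induced_copy F col False G)"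

text \<open>Induced Ramsey number: least number of vertices of a graph F arrowing (H,G).
  Any finite graph is isomorphic to one on natural-number vertices, so host graphs
  are taken on nat. Value is in enat; infinity if no such F exists.\<close>
definition IR :: "'a graph \<Rightarrow> 'c graph \<Rightarrow> enat" where
  "IR H G = Inf {enat (card (fst F)) | F :: nat graph. is_graph F \<and> ind_arrows F H G}"

end

(*
The host graph for r >= 2 has r independent parts: a part W_0 of bounded size N and parts W_1, ..., W_{r-1}
of about (r - 1) n vertices each, all of them blow-ups of one fixed quasirandom bipartite graph on N + N
vertices whose non-edges have a small density d > 0; N and d depend on H and gamma only.

If there is no blue induced star, then a vertex has fewer than n blue neighbours in each part. Choosing one
vertex from W_0, W_1, ... in turn, each new vertex has to avoid the blue neighbours and the non-neighbours of
at most r - 1 earlier ones, so a positive proportion of the transversals are red cliques. Duplicating one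
vertex at a time (Cauchy-Schwarz) yields a positive density of red complete r-partite graphs with parts of
size |V(H)|. Finally the red pairs that correspond to non-edges of H are traded, one by one, for non-edges of
the host: by quasirandomness this costs a factor d and an arbitrarily small additive error each time.
*)
theory Submission
  imports Defs "HOL-Analysis.Convex" "HOL-Computational_Algebra.Primes"
begin

section \<open>Summation rules and an explicit quasirandom bipartite graph modulo a prime\<close>

lemma sum_PiE_insert:
  fixes F :: "('i \<Rightarrow> 'b) \<Rightarrow> real"
  assumes "x \<notin> I"
  shows "(\<Sum>\<phi>\<in>PiE (insert x I) \<Omega>. F \<phi>) = (\<Sum>\<psi>\<in>PiE I \<Omega>. \<Sum>a\<in>\<Omega> x. F (\<psi>(x := a)))"
proof -
  have "(\<Sum>\<phi>\<in>PiE (insert x I) \<Omega>. F \<phi>)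
      = (\<Sum>(a, \<psi>)\<in>\<Omega> x \<times> PiE I \<Omega>. F (\<psi>(x := a)))"
    unfolding PiE_insert_eq
    by (subst sum.reindex[OF inj_combinator[OF assms]]) (simp add: case_prod_beta' o_def)
  also have "\<dots> = (\<Sum>a\<in>\<Omega> x. \<Sum>\<psi>\<in>PiE I \<Omega>. F (\<psi>(x := a)))"
    by (simp add: sum.cartesian_product)
  finally show ?thesis
    by (simp add: sum.swap[of _ "\<Omega> x"])
qed

text \<open>Multiplication by \<open>c\<close> is invertible modulo \<open>p\<close>, so the affine
  map merely permutes the residues.\<close>

lemma sum_mod_affine:
  fixes h :: "int \<Rightarrow> real" and p c d :: int
  assumes "prime p" "\<not> p dvd c"
  shows "(\<Sum>x\<in>{0..<p}. h ((c * x + d) mod p)) = (\<Sum>x\<in>{0..<p}. h x)"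
proof -
  have p: "p > 0" using assms(1) prime_gt_0_int by auto
  have inj: "inj_on (\<lambda>x. (c * x + d) mod p) {0..<p}"
  proof (rule inj_onI)
    fix x y assume xy: "x \<in> {0..<p}" "y \<in> {0..<p}" "(c * x + d) mod p = (c * y + d) mod p"
    then have "p dvd (c * x + d) - (c * y + d)" using mod_eq_dvd_iff by blast
    then have "p dvd c * (x - y)" by (simp add: algebra_simps)
    then have "p dvd x - y" using assms prime_dvd_mult_iff by blast
    then have "x mod p = y mod p" using mod_eq_dvd_iff by blast
    then show "x = y" using xy by simp
  qed
  have "(\<lambda>x. (c * x + d) mod p) ` {0..<p} = {0..<p}"
    by (rule endo_inj_surj[OF _ _ inj]) (use p in auto)
  with inj show ?thesis
    using sum.reindex[OF inj, of h] by (simp add: o_def)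
qed

text \<open>Distinct rows of the kernel are orthogonal unless they share the first coordinate, which leaves few
  correlated pairs of rows. The trivial bound would be \<open>p ^ 8\<close>.\<close>
lemma quasirandom_kernel:
  fixes f g :: "int \<times> int \<Rightarrow> real" and h :: "int \<Rightarrow> real" and p :: int
  defines "U \<equiv> {0..<p} \<times> {0..<p}"
  assumes p: "prime p"
    and h0: "(\<Sum>x\<in>{0..<p}. h x) = 0" and h1: "\<And>x. \<bar>h x\<bar> \<le> 1"
    and f: "\<And>u. u \<in> U \<Longrightarrow> \<bar>f u\<bar> \<le> 1" and g: "\<And>u. u \<in> U \<Longrightarrow> \<bar>g u\<bar> \<le> 1"
  shows "(\<Sum>u\<in>U. \<Sum>v\<in>U. f u * g v * h ((fst u * fst v + snd u + snd v) mod p))\<^sup>2 \<le> real_of_int p ^ 7"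
proof -
  define M where "M u v = h ((fst u * fst v + snd u + snd v) mod p)" for u v :: "int \<times> int"
  have p0: "p > 0" using p prime_gt_0_int by auto
  have fin: "finite U" unfolding U_def by simp
  have cU: "real (card U) = real_of_int p ^ 2"
    unfolding U_def using p0 by (simp add: card_cartesian_product power2_eq_square)
  have M1: "\<bar>M u v\<bar> \<le> 1" for u v unfolding M_def by (rule h1)
  have MM: "\<bar>\<Sum>v\<in>U. M u v * M u' v\<bar> \<le> (if fst u = fst u' then real_of_int p ^ 2 else 0)"
    if u: "u \<in> U" "u' \<in> U" for u u'
  proof (cases "fst u = fst u'")
    case True
    have "\<bar>\<Sum>v\<in>U. M u v * M u' v\<bar> \<le> (\<Sum>v\<in>U. 1)"
      by (rule order_trans[OF sum_abs sum_mono]) (simp add: abs_mult M1 mult_le_one)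
    then show ?thesis using True cU by simp
  next
    case False
    let ?e = "snd u' - snd u"
    have nd: "\<not> p dvd (fst u' - fst u)"
    proof
      assume "p dvd (fst u' - fst u)"
      then have "fst u' mod p = fst u mod p" using mod_eq_dvd_iff by blast
      then show False using u False unfolding U_def by auto
    qed
    \<comment> \<open>Write \<open>v = (x, y)\<close> and substitute the argument of the first
      factor for \<open>y\<close>. The second argument then differs from it by
      \<open>(fst u' - fst u) * x + ?e\<close>, whose slope is nonzero modulo \<open>p\<close>;
      summing over \<open>x\<close> first therefore runs through all residues and gives 0 by
      \<open>h0\<close>.\<close>
    have "(\<Sum>v\<in>U. M u v * M u' v)
        = (\<Sum>x\<in>{0..<p}. \<Sum>y\<in>{0..<p}. h ((1 * y + (fst u * x + snd u)) mod p) *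
             h (((fst u' - fst u) * x + ?e + (1 * y + (fst u * x + snd u)) mod p) mod p))"
      unfolding U_def sum.cartesian_product M_def
      by (rule sum.cong) (simp_all add: case_prod_beta mod_add_right_eq, simp add: algebra_simps)
    also have "\<dots> = (\<Sum>x\<in>{0..<p}. \<Sum>y\<in>{0..<p}. h y * h (((fst u' - fst u) * x + ?e + y) mod p))"
    proof (rule sum.cong[OF refl])
      fix x
      have "\<not> p dvd 1" using p not_prime_unit by blast
      then show "(\<Sum>y\<in>{0..<p}. h ((1 * y + (fst u * x + snd u)) mod p) *
             h (((fst u' - fst u) * x + ?e + (1 * y + (fst u * x + snd u)) mod p) mod p))
          = (\<Sum>y\<in>{0..<p}. h y * h (((fst u' - fst u) * x + ?e + y) mod p))"
        using sum_mod_affine[OF p, of 1 "\<lambda>y. h y * h (((fst u' - fst u) * x + ?e + y) mod p)"] by simp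
    qed
    also have "\<dots> = (\<Sum>y\<in>{0..<p}. h y * (\<Sum>x\<in>{0..<p}. h (((fst u' - fst u) * x + (?e + y)) mod p)))"
      by (subst sum.swap) (simp add: sum_distrib_left add.assoc)
    also have "\<dots> = 0"
      by (simp add: sum_mod_affine[OF p nd] h0)
    finally show ?thesis using False by simp
  qed
  \<comment> \<open>Cauchy-Schwarz over \<open>v\<close> will remove \<open>g\<close> at a cost of
    \<open>p ^ 2\<close> and leave the second moment of \<open>S\<close>. Expanding that moment
    pairs up rows: only \<open>p ^ 3\<close> pairs share the first coordinate, each worth at most
    \<open>p ^ 2\<close>, which makes \<open>p ^ 5\<close>.\<close>
  define S where "S v = (\<Sum>u\<in>U. f u * M u v)" for v
  have "(\<Sum>v\<in>U. (S v)\<^sup>2) = (\<Sum>v\<in>U. \<Sum>u\<in>U. \<Sum>u'\<in>U. f u * f u' * (M u v * M u' v))"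
    unfolding S_def power2_eq_square sum_product by (simp add: mult_ac)
  also have "\<dots> = (\<Sum>u\<in>U. \<Sum>u'\<in>U. f u * f u' * (\<Sum>v\<in>U. M u v * M u' v))"
    by (subst sum.swap) (simp add: sum_distrib_left, subst sum.swap, simp)
  also have "\<dots> \<le> (\<Sum>u\<in>U. \<Sum>u'\<in>U. if fst u = fst u' then real_of_int p ^ 2 else 0)"
  proof (intro sum_mono)
    fix u u' assume u: "u \<in> U" "u' \<in> U"
    have "f u * f u' * (\<Sum>v\<in>U. M u v * M u' v) \<le> \<bar>f u * f u'\<bar> * \<bar>\<Sum>v\<in>U. M u v * M u' v\<bar>"
      by (metis abs_ge_self abs_mult)
    also have "\<dots> \<le> 1 * \<bar>\<Sum>v\<in>U. M u v * M u' v\<bar>"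
      by (intro mult_right_mono) (use f u in \<open>auto simp: abs_mult mult_le_one\<close>)
    finally show "f u * f u' * (\<Sum>v\<in>U. M u v * M u' v) \<le> (if fst u = fst u' then real_of_int p ^ 2 else 0)"
      using MM[OF u] by linarith
  qed
  also have "\<dots> = (\<Sum>u\<in>U. real_of_int p ^ 3)"
  proof (rule sum.cong[OF refl])
    fix u assume u: "u \<in> U"
    have "(\<Sum>u'\<in>U. if fst u = fst u' then real_of_int p ^ 2 else 0)
        = (\<Sum>x\<in>{0..<p}. \<Sum>y\<in>{0..<p}. if fst u = x then real_of_int p ^ 2 else 0)"
      unfolding U_def sum.cartesian_product by (rule sum.cong) auto
    also have "\<dots> = (\<Sum>x\<in>{0..<p}. if fst u = x then real_of_int p ^ 3 else 0)"
      using p0 by (intro sum.cong) (auto simp: power2_eq_square power3_eq_cube)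
    also have "\<dots> = real_of_int p ^ 3" using u unfolding U_def by (auto simp: sum.delta)
    finally show "(\<Sum>u'\<in>U. if fst u = fst u' then real_of_int p ^ 2 else 0) = real_of_int p ^ 3" .
  qed
  also have "\<dots> = real_of_int p ^ 5" using cU by (simp add: power_add[symmetric])
  finally have S2: "(\<Sum>v\<in>U. (S v)\<^sup>2) \<le> real_of_int p ^ 5" .
  have "(\<Sum>u\<in>U. \<Sum>v\<in>U. f u * g v * M u v) = (\<Sum>v\<in>U. g v * S v)"
    unfolding S_def by (subst sum.swap) (simp add: sum_distrib_left mult_ac)
  also have "\<dots>\<^sup>2 \<le> (\<Sum>v\<in>U. (g v)\<^sup>2) * (\<Sum>v\<in>U. (S v)\<^sup>2)"
    by (rule Cauchy_Schwarz_ineq_sum)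
  also have "\<dots> \<le> real_of_int p ^ 2 * real_of_int p ^ 5"
  proof (rule mult_mono[OF _ S2])
    have "(\<Sum>v\<in>U. (g v)\<^sup>2) \<le> (\<Sum>v\<in>U. 1)"
      using g by (intro sum_mono) (simp add: abs_square_le_1)
    then show "(\<Sum>v\<in>U. (g v)\<^sup>2) \<le> real_of_int p ^ 2" using cU by simp
  qed (auto intro: sum_nonneg)
  finally show ?thesis unfolding M_def by (simp add: power_add[symmetric])
qed

text \<open>The points of the plane modulo a large prime serve as \<open>U\<close>, and
  \<open>D\<close> holds where the bilinear form of \<open>quasirandom_kernel\<close> falls among
  the first \<open>q\<close> residues. Centring this indicator at \<open>d = q / p\<close> gives a
  kernel function with sum 0, so the cut sum is at most \<open>p ^ (7/2)\<close>, compared with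
  \<open>card U ^ 2 = p ^ 4\<close>.\<close>

lemma quasirandom_bipartite_graph:
  fixes \<epsilon> \<eta> :: real
  assumes \<epsilon>: "0 < \<epsilon>" "\<epsilon> < 1" and \<eta>: "0 < \<eta>"
  shows "\<exists>(U :: (int \<times> int) set) D d. finite U \<and> U \<noteq> {} \<and> 1 \<le> \<eta> * real (card U) \<and> \<epsilon> / 2 \<le> d \<and> d \<le> \<epsilon> \<and>
    (\<forall>u\<in>U. real (card {v \<in> U. D u v}) = d * real (card U)) \<and>
    (\<forall>f g. (\<forall>u\<in>U. \<bar>f u\<bar> \<le> 1) \<longrightarrow> (\<forall>u\<in>U. \<bar>g u\<bar> \<le> 1) \<longrightarrow>
       \<bar>\<Sum>u\<in>U. \<Sum>v\<in>U. f u * g v * (of_bool (D u v) - d)\<bar> \<le> \<eta> * real (card U) ^ 2)"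
proof -
  \<comment> \<open>The bound \<open>2 / \<epsilon>\<close> ensures that rounding
    \<open>\<epsilon> * p\<close> down to \<open>q\<close> loses at most half the density,
    \<open>1 / \<eta>\<close> gives the size condition, and \<open>1 / \<eta>\<^sup>2\<close> turns
    \<open>p ^ 7\<close> into at most \<open>\<eta>\<^sup>2 * p ^ 8\<close>.\<close>
  obtain p' :: nat where p': "prime p'" "p' > nat \<lceil>max (2 / \<epsilon>) (max (1 / \<eta>) (1 / \<eta>\<^sup>2))\<rceil>"
    using bigger_prime by blast
  define p where "p = int p'"
  have p: "prime p" unfolding p_def using p'(1) by simp
  have "real_of_int p > max (2 / \<epsilon>) (max (1 / \<eta>) (1 / \<eta>\<^sup>2))"
    unfolding p_def using p'(2) by linarith
  then have big: "2 / \<epsilon> < p" "1 / \<eta> < p" "1 / \<eta>\<^sup>2 < p" by auto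
  have p0: "p > 0" using p prime_gt_0_int by auto
  define q where "q = \<lfloor>\<epsilon> * p\<rfloor>"
  define d where "d = real_of_int q / p"
  have "\<epsilon> * p \<le> 1 * real_of_int p" using \<epsilon> p0 by (intro mult_right_mono) auto
  then have q: "0 \<le> q" "q \<le> p" unfolding q_def using \<epsilon> p0 by (simp, linarith)
  have "q \<le> \<epsilon> * p" unfolding q_def by simp
  then have d1: "d \<le> \<epsilon>" unfolding d_def using p0 by (simp add: field_simps)
  have "q \<ge> \<epsilon> * p - 1" "2 \<le> \<epsilon> * p" unfolding q_def using big \<epsilon> by (linarith, simp add: field_simps)
  then have "q \<ge> \<epsilon> / 2 * p" by linarith
  then have d2: "\<epsilon> / 2 \<le> d" unfolding d_def using p0 by (simp add: field_simps)
  define U where "U = {0..<p} \<times> {0..<p}"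
  define D where "D u v \<longleftrightarrow> (fst u * fst v + snd u + snd v) mod p < q" for u v :: "int \<times> int"
  have cU: "real (card U) = real_of_int p ^ 2"
    unfolding U_def using p0 by (simp add: card_cartesian_product power2_eq_square)
  have fin: "finite U" and ne: "U \<noteq> {}" unfolding U_def using p0 by auto
  have sq: "(\<Sum>y\<in>{0..<p}. of_bool (y < q)) = real_of_int q"
  proof -
    have "{0..<p} \<inter> {y. y < q} = {0..<q}" using q by auto
    then show ?thesis using q by (simp add: of_bool_def sum.If_cases)
  qed
  have "1 \<le> \<eta> * p" using big \<eta> by (simp add: field_simps)
  also have "\<dots> \<le> \<eta> * p ^ 2" using \<eta> p0 by (simp add: self_le_power)
  finally have size: "1 \<le> \<eta> * real (card U)" using cU by simp
  \<comment> \<open>Degrees are exact: for each first coordinate of \<open>v\<close>, the tested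
    residue takes every value once as the second coordinate varies.\<close>
  have deg: "real (card {v \<in> U. D u v}) = d * real (card U)" if "u \<in> U" for u
  proof -
    have "real (card {v \<in> U. D u v}) = (\<Sum>v\<in>U. of_bool (D u v))"
      using fin by (simp add: of_bool_def sum.If_cases Int_def)
    also have "\<dots> = (\<Sum>x\<in>{0..<p}. \<Sum>y\<in>{0..<p}. of_bool ((1 * y + (fst u * x + snd u)) mod p < q))"
      unfolding U_def D_def sum.cartesian_product by (rule sum.cong) (auto simp: algebra_simps)
    also have "\<dots> = (\<Sum>x\<in>{0..<p}. real_of_int q)"
    proof (rule sum.cong[OF refl])
      fix x
      have "\<not> p dvd 1" using p not_prime_unit by blast
      from sum_mod_affine[OF p this, of "\<lambda>y. of_bool (y < q)"]
      show "(\<Sum>y\<in>{0..<p}. of_bool ((1 * y + (fst u * x + snd u)) mod p < q)) = real_of_int q"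
        unfolding sq by simp
    qed
    finally show ?thesis using p0 cU unfolding d_def by (simp add: power2_eq_square)
  qed
  have cut: "\<bar>\<Sum>u\<in>U. \<Sum>v\<in>U. f u * g v * (of_bool (D u v) - d)\<bar> \<le> \<eta> * real (card U) ^ 2"
    if "\<And>u. u \<in> U \<Longrightarrow> \<bar>f u\<bar> \<le> 1" "\<And>u. u \<in> U \<Longrightarrow> \<bar>g u\<bar> \<le> 1" for f g
  proof -
    have "d \<le> 1" "0 \<le> d" using d1 d2 \<epsilon> by auto
    then have bd: "\<bar>of_bool b - d\<bar> \<le> 1" for b by (cases b) auto
    have "(\<Sum>u\<in>U. \<Sum>v\<in>U. f u * g v * (of_bool (D u v) - d))\<^sup>2 \<le> real_of_int p ^ 7"
      using quasirandom_kernel[OF p, of "\<lambda>x. of_bool (x < q) - d" f g, OF _ bd] that p0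
      unfolding U_def D_def by (simp add: sum_subtractf sq d_def del: sum_of_bool_eq)
    also have "\<dots> \<le> (\<eta>\<^sup>2 * p) * real_of_int p ^ 7"
      using big(3) \<eta> p0 mult_right_mono[of 1 "\<eta>\<^sup>2 * p" "real_of_int p ^ 7"] by (auto simp: field_simps)
    also have "\<dots> = (\<eta> * real (card U) ^ 2)\<^sup>2"
      unfolding cU by (simp add: power_mult_distrib) (simp flip: power_mult add: eval_nat_numeral)
    finally show ?thesis
      using \<eta> by (simp add: abs_le_square_iff[symmetric] )
  qed
  show ?thesis using fin ne size d2 d1 deg cut by (intro exI[of _ U] exI[of _ D] exI[of _ d]) simp
qed

section \<open>Counting red complete multipartite configurations\<close>

text \<open>These are homomorphisms from a complete multipartite graph with classes given by
  \<open>c\<close>. Indices of one class may share a vertex, which keeps the Cauchy-Schwarz step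
  clean; such collisions are discarded only at the very end.\<close>

definition red_maps :: "(nat \<Rightarrow> 'v set) \<Rightarrow> ('v \<Rightarrow> 'v \<Rightarrow> bool) \<Rightarrow> (nat \<Rightarrow> nat) \<Rightarrow> nat \<Rightarrow> (nat \<Rightarrow> 'v) set" where
  "red_maps \<Omega> R c n =
    {\<phi> \<in> PiE {..<n} (\<lambda>x. \<Omega> (c x)). \<forall>x<n. \<forall>y<n. c x < c y \<longrightarrow> R (\<phi> x) (\<phi> y)}"

lemma card_filter_eq_sum_of_bool:
  "finite A \<Longrightarrow> real (card {x \<in> A. P x}) = (\<Sum>x\<in>A. of_bool (P x))"
  by (simp add: of_bool_def sum.If_cases Int_def)

text \<open>Greedy extension: each of the \<open>n < r\<close> vertices already chosen spoils at
  most a \<open>\<beta>\<close> share of the next part, so at least a \<open>\<delta>\<close> share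
  survives whatever the earlier choices were.\<close>

lemma card_red_maps_transversal:
  fixes \<Omega> :: "nat \<Rightarrow> 'v set"
  assumes fin: "\<And>s. s < r \<Longrightarrow> finite (\<Omega> s)" and c: "\<And>s. s < r \<Longrightarrow> c s = s"
    and deg: "\<And>i j v. i < j \<Longrightarrow> j < r \<Longrightarrow> v \<in> \<Omega> i \<Longrightarrow> real (card {a \<in> \<Omega> j. \<not> R v a}) \<le> \<beta> * real (card (\<Omega> j))"
    and \<delta>: "0 \<le> \<delta>" "\<delta> \<le> 1 - (real r - 1) * \<beta>" and \<beta>: "0 \<le> \<beta>"
    and "n \<le> r"
  shows "\<delta> ^ n * (\<Prod>s<n. real (card (\<Omega> s))) \<le> real (card (red_maps \<Omega> R c n))"
  using \<open>n \<le> r\<close>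
proof (induction n)
  case 0
  then show ?case by (simp add: red_maps_def)
next
  case (Suc n)
  let ?L = "\<lambda>x. \<Omega> (c x)"
  define Q where "Q n \<phi> \<longleftrightarrow> (\<forall>x<n. \<forall>y<n. c x < c y \<longrightarrow> R (\<phi> x) (\<phi> y))" for n \<phi>
  have finP: "finite (PiE {..<m} ?L)" if "m \<le> r" for m
    using that fin c by (intro finite_PiE) auto
  have step: "\<delta> * real (card (\<Omega> n)) \<le> real (card {a \<in> \<Omega> n. Q (Suc n) (\<psi>(n := a))})"
    if "\<psi> \<in> PiE {..<n} ?L" "Q n \<psi>" for \<psi>
  proof -
    \<comment> \<open>Below \<open>r\<close> the map \<open>c\<close> is the identity, so a newly
      violated pair must have \<open>n\<close> as its upper index.\<close>
    have sub: "{a \<in> \<Omega> n. \<not> Q (Suc n) (\<psi>(n := a))} \<subseteq> (\<Union>i<n. {a \<in> \<Omega> n. \<not> R (\<psi> i) a})"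
    proof
      fix a assume a: "a \<in> {a \<in> \<Omega> n. \<not> Q (Suc n) (\<psi>(n := a))}"
      then obtain x y where xy: "x < Suc n" "y < Suc n" "c x < c y" "\<not> R ((\<psi>(n := a)) x) ((\<psi>(n := a)) y)"
        unfolding Q_def by blast
      have "x < y" using xy Suc.prems c by auto
      then have "y = n" "x < n" using xy that(2) unfolding Q_def by (auto simp: less_Suc_eq)
      then show "a \<in> (\<Union>i<n. {a \<in> \<Omega> n. \<not> R (\<psi> i) a})" using xy a by auto
    qed
    have fn: "finite (\<Omega> n)" using fin Suc.prems by simp
    have "real (card {a \<in> \<Omega> n. \<not> Q (Suc n) (\<psi>(n := a))}) \<le> real (card (\<Union>i<n. {a \<in> \<Omega> n. \<not> R (\<psi> i) a}))"
      using sub fn by (intro of_nat_mono card_mono) auto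
    also have "\<dots> \<le> (\<Sum>i<n. real (card {a \<in> \<Omega> n. \<not> R (\<psi> i) a}))"
      unfolding of_nat_sum[symmetric] by (intro of_nat_mono card_UN_le) simp
    also have "\<dots> \<le> (\<Sum>i<n. \<beta> * real (card (\<Omega> n)))"
    proof (rule sum_mono)
      fix i assume "i \<in> {..<n}"
      then show "real (card {a \<in> \<Omega> n. \<not> R (\<psi> i) a}) \<le> \<beta> * real (card (\<Omega> n))"
        using deg[of i n "\<psi> i"] that(1) Suc.prems c[of i] by (auto simp: PiE_def Pi_def)
    qed
    also have "\<dots> = real n * \<beta> * real (card (\<Omega> n))" by simp
    also have "\<dots> \<le> (1 - \<delta>) * real (card (\<Omega> n))"
    proof (rule mult_right_mono)
      have "real n * \<beta> \<le> (real r - 1) * \<beta>" using Suc.prems \<beta> by (intro mult_right_mono) auto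
      then show "real n * \<beta> \<le> 1 - \<delta>" using \<delta> by linarith
    qed auto
    finally have bad: "real (card {a \<in> \<Omega> n. \<not> Q (Suc n) (\<psi>(n := a))}) \<le> (1 - \<delta>) * real (card (\<Omega> n))" .
    have "\<Omega> n = {a \<in> \<Omega> n. Q (Suc n) (\<psi>(n := a))} \<union> {a \<in> \<Omega> n. \<not> Q (Suc n) (\<psi>(n := a))}" by blast
    then have "real (card (\<Omega> n)) \<le> real (card {a \<in> \<Omega> n. Q (Suc n) (\<psi>(n := a))})
        + real (card {a \<in> \<Omega> n. \<not> Q (Suc n) (\<psi>(n := a))})"
      by (metis card_Un_le of_nat_add of_nat_mono)
    then show ?thesis using bad by (simp add: algebra_simps)
  qed
  have "\<delta> ^ Suc n * (\<Prod>s<Suc n. real (card (\<Omega> s)))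
      = (\<delta> ^ n * (\<Prod>s<n. real (card (\<Omega> s)))) * (\<delta> * real (card (\<Omega> n)))"
    by (simp add: mult_ac)
  also have "\<dots> \<le> real (card (red_maps \<Omega> R c n)) * (\<delta> * real (card (\<Omega> n)))"
    using Suc \<delta> by (intro mult_right_mono) auto
  also have "\<dots> = (\<Sum>\<psi>\<in>PiE {..<n} ?L. of_bool (Q n \<psi>) * (\<delta> * real (card (\<Omega> n))))"
    using finP[of n] Suc.prems
    by (simp add: red_maps_def Q_def card_filter_eq_sum_of_bool sum_distrib_right del: sum_of_bool_eq)
  also have "\<dots> \<le> (\<Sum>\<psi>\<in>PiE {..<n} ?L. \<Sum>a\<in>\<Omega> n. of_bool (Q (Suc n) (\<psi>(n := a))))"
  proof (rule sum_mono)
    fix \<psi> assume "\<psi> \<in> PiE {..<n} ?L"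
    then show "of_bool (Q n \<psi>) * (\<delta> * real (card (\<Omega> n))) \<le> (\<Sum>a\<in>\<Omega> n. of_bool (Q (Suc n) (\<psi>(n := a))))"
      using step[of \<psi>] fin[of n] Suc.prems
      by (cases "Q n \<psi>") (auto simp: card_filter_eq_sum_of_bool intro!: sum_nonneg)
  qed
  also have "\<dots> = real (card (red_maps \<Omega> R c (Suc n)))"
    using finP[OF Suc.prems] c[of n] Suc.prems
    by (simp add: red_maps_def Q_def card_filter_eq_sum_of_bool lessThan_Suc sum_PiE_insert[of n "{..<n}"] del: sum_of_bool_eq)
  finally show ?case .
qed

text \<open>The index n becomes a second copy of x: a map extended by n is red if both choices for the vertex at x
  give red maps, so Cauchy--Schwarz squares the density.\<close>
lemma card_red_maps_duplicate:
  fixes \<Omega> :: "nat \<Rightarrow> 'v set"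
  assumes fin: "\<And>i. i \<le> n \<Longrightarrow> finite (\<Omega> (c i))" and ne: "\<And>i. i \<le> n \<Longrightarrow> \<Omega> (c i) \<noteq> {}"
    and x: "x < n" "c x = c n" and b: "b \<ge> 0"
    and IH: "b * (\<Prod>s<n. real (card (\<Omega> (c s)))) \<le> real (card (red_maps \<Omega> R c n))"
  shows "b\<^sup>2 * (\<Prod>s<Suc n. real (card (\<Omega> (c s)))) \<le> real (card (red_maps \<Omega> R c (Suc n)))"
proof -
  let ?L = "\<lambda>x. \<Omega> (c x)"
  define J where "J = {..<n} - {x}"
  have J: "finite J" "x \<notin> J" "n \<notin> J" "n \<notin> insert x J" "{..<n} = insert x J" "{..<Suc n} = insert n (insert x J)"
    unfolding J_def using x by auto
  define Q where "Q n \<phi> \<longleftrightarrow> (\<forall>x<n. \<forall>y<n. c x < c y \<longrightarrow> R (\<phi> x) (\<phi> y))" for n \<phi>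
  have finP: "finite (PiE {..<m} ?L)" if "m \<le> Suc n" for m
    using that fin by (intro finite_PiE) auto
  \<comment> \<open>\<open>s \<psi>\<close> is the number of ways to complete \<open>\<psi>\<close>
    at \<open>x\<close>. Its sum counts the maps on \<open>n\<close> indices, while its sum of
    squares counts pairs of completions, that is, candidates for maps on \<open>Suc n\<close>
    indices.\<close>
  define s where "s \<psi> = (\<Sum>a\<in>?L x. of_bool (Q n (\<psi>(x := a))) :: real)" for \<psi>
  have cn: "real (card (red_maps \<Omega> R c n)) = (\<Sum>\<psi>\<in>PiE J ?L. s \<psi>)"
  proof -
    have "real (card (red_maps \<Omega> R c n)) = (\<Sum>\<phi>\<in>PiE (insert x J) ?L. of_bool (Q n \<phi>))"
      using finP[of n] J(5) by (simp add: red_maps_def Q_def card_filter_eq_sum_of_bool)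
    then show ?thesis using J(2) by (simp add: sum_PiE_insert s_def)
  qed
  have "(\<Sum>\<psi>\<in>PiE J ?L. (s \<psi>)\<^sup>2)
      = (\<Sum>\<psi>\<in>PiE J ?L. \<Sum>a\<in>?L x. \<Sum>b\<in>?L n. of_bool (Q n (\<psi>(x := a)) \<and> Q n (\<psi>(x := b))))"
    using x by (simp add: s_def power2_eq_square sum_product of_bool_conj)
  also have "\<dots> \<le> (\<Sum>\<psi>\<in>PiE J ?L. \<Sum>a\<in>?L x. \<Sum>b\<in>?L n. of_bool (Q (Suc n) (\<psi>(x := a, n := b))))"
  proof (intro sum_mono)
    fix \<psi> a b
    \<comment> \<open>Pairs involving \<open>n\<close> are inherited from the second completion,
      where \<open>b\<close> sits at \<open>x\<close>. The other index of such a pair is never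
      \<open>x\<close>, because \<open>x\<close> and \<open>n\<close> belong to the same
      class.\<close>
    have "Q (Suc n) (\<psi>(x := a, n := b))" if q: "Q n (\<psi>(x := a))" "Q n (\<psi>(x := b))"
      unfolding Q_def
    proof (intro allI impI)
      fix u v assume uv: "u < Suc n" "v < Suc n" "c u < c v"
      consider "u < n" "v < n" | "u = n" "v < n" | "u < n" "v = n" using uv by (auto simp: less_Suc_eq)
      then show "R ((\<psi>(x := a, n := b)) u) ((\<psi>(x := a, n := b)) v)"
      proof cases
        case 1
        then show ?thesis using q(1) uv unfolding Q_def by auto
      next
        case 2
        then have "v \<noteq> x" using x uv by auto
        moreover have "R ((\<psi>(x := b)) x) ((\<psi>(x := b)) v)" using q(2) uv 2 x unfolding Q_def by metis
        ultimately show ?thesis using 2 by auto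
      next
        case 3
        then have "u \<noteq> x" using x uv by auto
        moreover have "R ((\<psi>(x := b)) u) ((\<psi>(x := b)) x)" using q(2) uv 3 x unfolding Q_def by metis
        ultimately show ?thesis using 3 by auto
      qed
    qed
    then show "of_bool (Q n (\<psi>(x := a)) \<and> Q n (\<psi>(x := b))) \<le> (of_bool (Q (Suc n) (\<psi>(x := a, n := b))) :: real)"
      by auto
  qed
  also have "\<dots> = real (card (red_maps \<Omega> R c (Suc n)))"
    using finP[of "Suc n"] J
    by (simp add: red_maps_def Q_def[symmetric] card_filter_eq_sum_of_bool sum_PiE_insert del: lessThan_Suc sum_of_bool_eq)
  finally have c2: "(\<Sum>\<psi>\<in>PiE J ?L. (s \<psi>)\<^sup>2) \<le> real (card (red_maps \<Omega> R c (Suc n)))" .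
  define K where "K = (\<Prod>i\<in>J. real (card (?L i)))"
  define w where "w = real (card (?L n))"
  have pos: "real (card (?L i)) > 0" if "i \<le> n" for i
    using fin[OF that] ne[OF that] by (simp add: card_gt_0_iff)
  have K: "K > 0" "w > 0" unfolding K_def w_def using pos by (auto intro!: prod_pos simp: J_def)
  have PK: "real (card (PiE J ?L)) = K" unfolding K_def using J(1) by (simp add: card_PiE)
  \<comment> \<open>\<open>K\<close> counts the choices outside \<open>x\<close>, and
    \<open>w\<close> is the common size of the parts at \<open>x\<close> and \<open>n\<close>; one
    factor \<open>K\<close> is lost to Cauchy-Schwarz and cancels.\<close>
  have "(b * (K * w))\<^sup>2 \<le> (\<Sum>\<psi>\<in>PiE J ?L. s \<psi>)\<^sup>2"
    using IH cn J x b K by (intro power_mono) (auto simp: K_def w_def mult_ac)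
  also have "\<dots> \<le> K * (\<Sum>\<psi>\<in>PiE J ?L. (s \<psi>)\<^sup>2)"
    using Cauchy_Schwarz_ineq_sum[of "\<lambda>_. 1" s "PiE J ?L"] PK by simp
  also have "\<dots> \<le> K * real (card (red_maps \<Omega> R c (Suc n)))"
    using c2 K by (intro mult_left_mono) auto
  finally have "K * (b\<^sup>2 * (K * w * w)) \<le> K * real (card (red_maps \<Omega> R c (Suc n)))"
    by (simp add: power2_eq_square mult_ac)
  then have "b\<^sup>2 * (K * w * w) \<le> real (card (red_maps \<Omega> R c (Suc n)))" using K by simp
  moreover have "(\<Prod>s<Suc n. real (card (\<Omega> (c s)))) = K * w * w"
    unfolding J(6) K_def w_def using J x by (simp add: mult_ac)
  ultimately show ?thesis by simp
qed

text \<open>The transversals give density \<open>\<delta> ^ r\<close>, and each of the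
  \<open>k\<close> duplications squares the density.\<close>

lemma card_red_maps_ge:
  fixes \<Omega> :: "nat \<Rightarrow> 'v set"
  assumes fin: "\<And>s. s < r \<Longrightarrow> finite (\<Omega> s)" and ne: "\<And>s. s < r \<Longrightarrow> \<Omega> s \<noteq> {}"
    and c: "\<And>s. s < r \<Longrightarrow> c s = s" and cr: "\<And>i. c i < r"
    and deg: "\<And>i j v. i < j \<Longrightarrow> j < r \<Longrightarrow> v \<in> \<Omega> i \<Longrightarrow> real (card {a \<in> \<Omega> j. \<not> R v a}) \<le> \<beta> * real (card (\<Omega> j))"
    and \<delta>: "0 \<le> \<delta>" "\<delta> \<le> 1 - (real r - 1) * \<beta>" and \<beta>: "0 \<le> \<beta>"
  shows "(\<delta> ^ r) ^ 2 ^ k * (\<Prod>s<r + k. real (card (\<Omega> (c s)))) \<le> real (card (red_maps \<Omega> R c (r + k)))"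
proof (induction k)
  case 0
  have "(\<Prod>s<r. real (card (\<Omega> (c s)))) = (\<Prod>s<r. real (card (\<Omega> s)))"
    by (rule prod.cong) (auto simp: c)
  then show ?case using card_red_maps_transversal[where n = r, OF fin c deg \<delta> \<beta>] by simp
next
  case (Suc k)
  \<comment> \<open>The index to be duplicated is the transversal one in the same class, namely
    \<open>c (r + k)\<close> itself.\<close>
  have "c (c (r + k)) = c (r + k)" "c (r + k) < r + k" using c cr by (auto simp: trans_less_add1)
  then show ?case
    using card_red_maps_duplicate[of "r + k" \<Omega> c "c (r + k)" "(\<delta> ^ r) ^ 2 ^ k" R] fin ne cr \<delta> Suc.IH
    by (simp add: power_mult[symmetric] mult_ac)
qed

section \<open>Trading red pairs for non-edges and avoiding collisions\<close>

text \<open>Once all coordinates except \<open>x\<close> and \<open>y\<close> are fixed,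
  \<open>w1\<close> depends only on the value at \<open>x\<close> and \<open>w2\<close> only on the
  value at \<open>y\<close>. The cut bound then applies to each inner double sum.\<close>

lemma cut_norm_sum_PiE:
  fixes w1 w2 :: "('i \<Rightarrow> 'v) \<Rightarrow> real"
  assumes fin: "finite I" and xy: "x \<in> I" "y \<in> I" "x \<noteq> y"
    and b1: "\<And>\<phi>. \<bar>w1 \<phi>\<bar> \<le> 1" and b2: "\<And>\<phi>. \<bar>w2 \<phi>\<bar> \<le> 1"
    and w1: "\<And>\<phi> b. w1 (\<phi>(y := b)) = w1 \<phi>" and w2: "\<And>\<phi> a. w2 (\<phi>(x := a)) = w2 \<phi>"
    and cut: "\<And>f g. (\<And>u. \<bar>f u\<bar> \<le> 1) \<Longrightarrow> (\<And>v. \<bar>g v\<bar> \<le> 1) \<Longrightarrow>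
       \<bar>\<Sum>u\<in>\<Lambda> x. \<Sum>v\<in>\<Lambda> y. f u * g v * (of_bool (D u v) - d)\<bar> \<le> \<eta> * real (card (\<Lambda> x)) * real (card (\<Lambda> y))"
  shows "\<bar>\<Sum>\<phi>\<in>PiE I \<Lambda>. w1 \<phi> * w2 \<phi> * (of_bool (D (\<phi> x) (\<phi> y)) - d)\<bar> \<le> \<eta> * (\<Prod>i\<in>I. real (card (\<Lambda> i)))"
proof -
  define J where "J = I - {x, y}"
  have J: "finite J" "x \<notin> J" "y \<notin> J" "y \<notin> insert x J" "I = insert y (insert x J)"
    unfolding J_def using xy fin by auto
  have "(\<Sum>\<phi>\<in>PiE I \<Lambda>. w1 \<phi> * w2 \<phi> * (of_bool (D (\<phi> x) (\<phi> y)) - d))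
     = (\<Sum>\<psi>\<in>PiE J \<Lambda>. \<Sum>a\<in>\<Lambda> x. \<Sum>b\<in>\<Lambda> y. w1 (\<psi>(x := a)) * w2 (\<psi>(y := b)) * (of_bool (D a b) - d))"
  proof -
    have "w2 (\<psi>(x := a, y := b)) = w2 (\<psi>(y := b))" for \<psi> a b
      using w2[of "\<psi>(y := b)" a] xy by (simp add: fun_upd_twist)
    then show ?thesis
      unfolding J(5) sum_PiE_insert[OF J(4)] sum_PiE_insert[OF J(2)] using xy by (simp add: w1)
  qed
  also have "\<bar>\<dots>\<bar> \<le> (\<Sum>\<psi>\<in>PiE J \<Lambda>. \<eta> * real (card (\<Lambda> x)) * real (card (\<Lambda> y)))"
    by (rule order_trans[OF sum_abs sum_mono]) (intro cut b1 b2)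
  also have "\<dots> = \<eta> * (\<Prod>i\<in>I. real (card (\<Lambda> i)))"
    unfolding J(5) using J xy by (simp add: card_PiE)
  finally show ?thesis .
qed

text \<open>Non-edges are imposed one pair at a time. Replacing the indicator of \<open>D\<close> by
  its mean \<open>d\<close> changes the count by at most an \<open>\<eta>\<close> share of all maps,
  however irregular \<open>R\<close> is. Earlier errors are multiplied by \<open>d \<le> 1\<close>,
  so the errors at most add up.\<close>

lemma card_PiE_nonedges:
  fixes \<Lambda> :: "'i \<Rightarrow> 'v set" and c :: "'i \<Rightarrow> nat" and R D :: "'v \<Rightarrow> 'v \<Rightarrow> bool"
  defines "B I \<equiv> {(x, y). x \<in> I \<and> y \<in> I \<and> c x < c y}"
  assumes fin: "finite I" "\<And>i. i \<in> I \<Longrightarrow> finite (\<Lambda> i)" and d: "0 \<le> d" "d \<le> 1"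
    and cut: "\<And>x y f g. (x, y) \<in> B I \<Longrightarrow> (\<And>u. \<bar>f u\<bar> \<le> 1) \<Longrightarrow> (\<And>v. \<bar>g v\<bar> \<le> 1) \<Longrightarrow>
       \<bar>\<Sum>u\<in>\<Lambda> x. \<Sum>v\<in>\<Lambda> y. f u * g v * (of_bool (D u v) - d)\<bar> \<le> \<eta> * real (card (\<Lambda> x)) * real (card (\<Lambda> y))"
    and A: "A \<subseteq> B I" and \<eta>: "\<eta> \<ge> 0"
  shows "finite P \<Longrightarrow> P \<subseteq> B I \<Longrightarrow> A \<inter> P = {} \<Longrightarrow>
    d ^ card P * real (card {\<phi> \<in> PiE I \<Lambda>. \<forall>(x, y)\<in>A. R (\<phi> x) (\<phi> y)})
      - real (card P) * \<eta> * (\<Prod>i\<in>I. real (card (\<Lambda> i)))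
    \<le> real (card {\<phi> \<in> PiE I \<Lambda>. (\<forall>(x, y)\<in>A. R (\<phi> x) (\<phi> y)) \<and> (\<forall>(x, y)\<in>P. D (\<phi> x) (\<phi> y))})"
proof (induction P rule: finite_induct)
  case empty
  then show ?case by simp
next
  case (insert e P)
  obtain x y where e: "e = (x, y)" by fastforce
  have exy: "(x, y) \<in> B I" using insert.prems e by auto
  then have xy: "x \<in> I" "y \<in> I" "c x < c y" unfolding B_def by auto
  define G where "G \<phi> \<longleftrightarrow> (\<forall>(x, y)\<in>A. R (\<phi> x) (\<phi> y)) \<and> (\<forall>(x, y)\<in>P. D (\<phi> x) (\<phi> y))" for \<phi>
  \<comment> \<open>The pairs not involving y do not constrain \<open>\<phi> y\<close>, the remaining ones do not constrain \<open>\<phi> x\<close>: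
    for fixed values elsewhere the indicator of G is a product \<open>f (\<phi> x) * g (\<phi> y)\<close>.\<close>
  define w1 :: "('i \<Rightarrow> 'v) \<Rightarrow> real" where "w1 \<phi> = of_bool ((\<forall>(u, v)\<in>A. u \<noteq> y \<and> v \<noteq> y \<longrightarrow> R (\<phi> u) (\<phi> v)) \<and>
      (\<forall>(u, v)\<in>P. u \<noteq> y \<and> v \<noteq> y \<longrightarrow> D (\<phi> u) (\<phi> v)))" for \<phi>
  define w2 :: "('i \<Rightarrow> 'v) \<Rightarrow> real" where "w2 \<phi> = of_bool ((\<forall>(u, v)\<in>A. u = y \<or> v = y \<longrightarrow> R (\<phi> u) (\<phi> v)) \<and>
      (\<forall>(u, v)\<in>P. u = y \<or> v = y \<longrightarrow> D (\<phi> u) (\<phi> v)))" for \<phi>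
  have split: "(\<forall>(u, v)\<in>S. T u v) \<longleftrightarrow> (\<forall>(u, v)\<in>S. u \<noteq> y \<and> v \<noteq> y \<longrightarrow> T u v) \<and> (\<forall>(u, v)\<in>S. u = y \<or> v = y \<longrightarrow> T u v)"
    for S and T :: "'i \<Rightarrow> 'i \<Rightarrow> bool"
    by fast
  have w12: "w1 \<phi> * w2 \<phi> = of_bool (G \<phi>)" for \<phi>
    using split[of A "\<lambda>u v. R (\<phi> u) (\<phi> v)"] split[of P "\<lambda>u v. D (\<phi> u) (\<phi> v)"]
    unfolding w1_def w2_def G_def of_bool_conj[symmetric] by (intro arg_cong[where f = of_bool]) argo
  \<comment> \<open>A constraint on both \<open>x\<close> and \<open>y\<close> would be
    \<open>(x, y)\<close> itself, which lies in neither \<open>A\<close> nor \<open>P\<close>, or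
    \<open>(y, x)\<close>, which the order of the classes forbids.\<close>
  have xnot: "u \<noteq> x \<and> v \<noteq> x" if "(u, v) \<in> A \<union> P" "u = y \<or> v = y" for u v
  proof -
    have "(u, v) \<in> B I" "(u, v) \<noteq> (x, y)" using that A insert.prems insert.hyps e by auto
    then show ?thesis using that(2) xy unfolding B_def by auto
  qed
  have 1: "\<bar>\<Sum>\<phi>\<in>PiE I \<Lambda>. w1 \<phi> * w2 \<phi> * (of_bool (D (\<phi> x) (\<phi> y)) - d)\<bar> \<le> \<eta> * (\<Prod>i\<in>I. real (card (\<Lambda> i)))"
  proof (rule cut_norm_sum_PiE[OF fin(1)])
    show "w1 (\<phi>(y := b)) = w1 \<phi>" for \<phi> b
      unfolding w1_def by (rule arg_cong[where f = of_bool], intro arg_cong2[where f = "(\<and>)"] ball_cong) auto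
    show "w2 (\<phi>(x := a)) = w2 \<phi>" for \<phi> a
      unfolding w2_def
      by (rule arg_cong[where f = of_bool], intro arg_cong2[where f = "(\<and>)"] ball_cong) (use xnot in auto)
  qed (use cut[OF exy] xy in \<open>auto simp: w1_def w2_def\<close>)
  have finP: "finite (PiE I \<Lambda>)" using fin by (intro finite_PiE) auto
  have G': "{\<phi> \<in> PiE I \<Lambda>. (\<forall>(x, y)\<in>A. R (\<phi> x) (\<phi> y)) \<and> (\<forall>(x, y)\<in>insert e P. D (\<phi> x) (\<phi> y))}
      = {\<phi> \<in> PiE I \<Lambda>. G \<phi> \<and> D (\<phi> x) (\<phi> y)}"
    unfolding G_def e by auto
  have "(\<Sum>\<phi>\<in>PiE I \<Lambda>. w1 \<phi> * w2 \<phi> * (of_bool (D (\<phi> x) (\<phi> y)) - d))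
      = real (card {\<phi> \<in> PiE I \<Lambda>. G \<phi> \<and> D (\<phi> x) (\<phi> y)}) - d * real (card {\<phi> \<in> PiE I \<Lambda>. G \<phi>})"
    unfolding card_filter_eq_sum_of_bool[OF finP] sum_distrib_left sum_subtractf[symmetric] w12
    by (rule sum.cong) (auto simp: of_bool_conj algebra_simps)
  with 1 have 2: "d * real (card {\<phi> \<in> PiE I \<Lambda>. G \<phi>}) - \<eta> * (\<Prod>i\<in>I. real (card (\<Lambda> i)))
      \<le> real (card {\<phi> \<in> PiE I \<Lambda>. G \<phi> \<and> D (\<phi> x) (\<phi> y)})" by linarith
  have IH: "d ^ card P * real (card {\<phi> \<in> PiE I \<Lambda>. \<forall>(x, y)\<in>A. R (\<phi> x) (\<phi> y)})
      - real (card P) * \<eta> * (\<Prod>i\<in>I. real (card (\<Lambda> i))) \<le> real (card {\<phi> \<in> PiE I \<Lambda>. G \<phi>})"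
    unfolding G_def by (rule insert.IH) (use insert.prems in auto)
  have "d * (real (card P) * \<eta> * (\<Prod>i\<in>I. real (card (\<Lambda> i)))) \<le> 1 * (real (card P) * \<eta> * (\<Prod>i\<in>I. real (card (\<Lambda> i))))"
    using d \<eta> by (intro mult_right_mono) (auto intro!: mult_nonneg_nonneg prod_nonneg)
  with mult_left_mono[OF IH d(1)] 2 show ?case
    unfolding G' using insert.hyps by (simp add: algebra_simps)
qed

text \<open>In a collision the value at \<open>x\<close> is determined by the value at
  \<open>y\<close>, so only the coordinates other than \<open>x\<close> are free.\<close>

lemma card_PiE_collision:
  fixes \<Lambda> :: "'i \<Rightarrow> 'v set"
  assumes fin: "finite I" "\<And>i. i \<in> I \<Longrightarrow> finite (\<Lambda> i)" and xy: "x \<in> I" "y \<in> I" "x \<noteq> y"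
  shows "real (card {\<phi> \<in> PiE I \<Lambda>. \<phi> x = \<phi> y}) * real (card (\<Lambda> x)) \<le> (\<Prod>i\<in>I. real (card (\<Lambda> i)))"
proof -
  define J where "J = I - {x}"
  have J: "finite J" "x \<notin> J" "y \<in> J" "I = insert x J" unfolding J_def using xy fin by auto
  have "finite (PiE I \<Lambda>)" using fin by (intro finite_PiE) auto
  then have "real (card {\<phi> \<in> PiE I \<Lambda>. \<phi> x = \<phi> y}) = (\<Sum>\<psi>\<in>PiE J \<Lambda>. \<Sum>a\<in>\<Lambda> x. of_bool (a = \<psi> y))"
    unfolding card_filter_eq_sum_of_bool[OF \<open>finite (PiE I \<Lambda>)\<close>]
    unfolding J(4) sum_PiE_insert[OF J(2)] using xy by (simp del: sum_of_bool_eq)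
  also have "\<dots> \<le> (\<Sum>\<psi>\<in>PiE J \<Lambda>. 1)"
  proof (rule sum_mono)
    fix \<psi>
    have "(\<Sum>a\<in>\<Lambda> x. of_bool (a = \<psi> y)) = (of_bool (\<psi> y \<in> \<Lambda> x) :: real)"
      using fin(2)[OF xy(1)] by (simp add: of_bool_def sum.delta del: sum_of_bool_eq)
    then show "(\<Sum>a\<in>\<Lambda> x. of_bool (a = \<psi> y)) \<le> (1 :: real)" by (simp del: sum_of_bool_eq)
  qed
  also have "\<dots> = (\<Prod>i\<in>J. real (card (\<Lambda> i)))" using J by (simp add: card_PiE)
  finally show ?thesis
    unfolding J(4) using J by (simp add: mult.commute mult_left_mono)
qed

text \<open>The indices below r are the transversal clique, the k indices from r on are the vertices of the graph to
  be embedded; N lists the pairs that have to become non-edges.\<close>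
lemma induced_blowup_embedding:
  fixes \<Omega> :: "nat \<Rightarrow> 'v set" and R D :: "'v \<Rightarrow> 'v \<Rightarrow> bool" and c :: "nat \<Rightarrow> nat"
  assumes n: "n = r + k" and fin: "\<And>s. s < r \<Longrightarrow> finite (\<Omega> s)" and ne: "\<And>s. s < r \<Longrightarrow> \<Omega> s \<noteq> {}"
    and c: "\<And>s. s < r \<Longrightarrow> c s = s" and cr: "\<And>i. c i < r"
    and deg: "\<And>i j v. i < j \<Longrightarrow> j < r \<Longrightarrow> v \<in> \<Omega> i \<Longrightarrow> real (card {a \<in> \<Omega> j. \<not> R v a}) \<le> \<beta> * real (card (\<Omega> j))"
    and \<delta>: "0 \<le> \<delta>" "\<delta> \<le> 1 - (real r - 1) * \<beta>" and \<beta>: "0 \<le> \<beta>"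
    and cut: "\<And>i j f g. i < j \<Longrightarrow> j < r \<Longrightarrow> (\<And>u. \<bar>f u\<bar> \<le> 1) \<Longrightarrow> (\<And>v. \<bar>g v\<bar> \<le> 1) \<Longrightarrow>
       \<bar>\<Sum>u\<in>\<Omega> i. \<Sum>v\<in>\<Omega> j. f u * g v * (of_bool (D u v) - d)\<bar> \<le> \<eta> * real (card (\<Omega> i)) * real (card (\<Omega> j))"
    and size: "\<And>s. s < r \<Longrightarrow> 1 \<le> \<eta> * real (card (\<Omega> s))"
    and d: "0 \<le> d" "d \<le> 1" and \<eta>: "0 \<le> \<eta>"
    and big: "2 * real n ^ 2 * \<eta> < d ^ n ^ 2 * (\<delta> ^ r) ^ 2 ^ k"
  shows "\<exists>\<phi>. (\<forall>x<n. \<phi> x \<in> \<Omega> (c x)) \<and>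
    (\<forall>x<n. \<forall>y<n. c x < c y \<longrightarrow> (if (x, y) \<in> N then D (\<phi> x) (\<phi> y) else R (\<phi> x) (\<phi> y))) \<and>
    (\<forall>x<n. \<forall>y<n. c x = c y \<longrightarrow> x \<noteq> y \<longrightarrow> \<phi> x \<noteq> \<phi> y)"
proof -
  let ?L = "\<lambda>x. \<Omega> (c x)"
  define B where "B = {(x, y). x \<in> {..<n} \<and> y \<in> {..<n} \<and> c x < c y}"
  define P where "P = B \<inter> N"
  define A where "A = B - N"
  define K where "K = (\<Prod>i<n. real (card (?L i)))"
  have finL: "finite (?L i)" and neL: "?L i \<noteq> {}" for i using fin ne cr by auto
  then have K: "K > 0" unfolding K_def by (intro prod_pos) (simp add: card_gt_0_iff)
  have finP: "finite (PiE {..<n} ?L)" using finL by (intro finite_PiE) auto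
  have sub: "B \<subseteq> {..<n} \<times> {..<n}" unfolding B_def by auto
  then have finB: "finite B" by (rule finite_subset) simp
  have "card P \<le> card ({..<n} \<times> {..<n})" using sub unfolding P_def by (intro card_mono) auto
  then have cP: "card P \<le> n ^ 2" by (simp add: power2_eq_square)
  define X where "X = {\<phi> \<in> PiE {..<n} ?L. (\<forall>(x, y)\<in>A. R (\<phi> x) (\<phi> y)) \<and> (\<forall>(x, y)\<in>P. D (\<phi> x) (\<phi> y))}"
  have "d ^ n\<^sup>2 * ((\<delta> ^ r) ^ 2 ^ k * K) \<le> d ^ card P * real (card (red_maps \<Omega> R c n))"
    unfolding K_def n
    by (intro mult_mono card_red_maps_ge[OF fin ne c cr deg \<delta> \<beta>] power_decreasing)
       (use cP d \<delta> in \<open>auto simp: n intro!: mult_nonneg_nonneg prod_nonneg\<close>)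
  \<comment> \<open>Redness is forgotten on the pairs of \<open>P\<close> before they are turned
    into non-edges.\<close>
  also have "\<dots> \<le> d ^ card P * real (card {\<phi> \<in> PiE {..<n} ?L. \<forall>(x, y)\<in>A. R (\<phi> x) (\<phi> y)})"
    using finP d unfolding red_maps_def A_def B_def
    by (intro mult_left_mono of_nat_mono card_mono) auto
  also have "\<dots> \<le> real (card X) + real (card P) * \<eta> * K"
  proof -
    have "d ^ card P * real (card {\<phi> \<in> PiE {..<n} ?L. \<forall>(x, y)\<in>A. R (\<phi> x) (\<phi> y)}) - real (card P) * \<eta> * K \<le> real (card X)"
      unfolding X_def K_def
    proof (rule card_PiE_nonedges[where c = c])
      show "\<bar>\<Sum>u\<in>?L x. \<Sum>v\<in>?L y. f u * g v * (of_bool (D u v) - d)\<bar> \<le> \<eta> * real (card (?L x)) * real (card (?L y))"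
        if "(x, y) \<in> {(x, y). x \<in> {..<n} \<and> y \<in> {..<n} \<and> c x < c y}" "\<And>u. \<bar>f u\<bar> \<le> 1" "\<And>v. \<bar>g v\<bar> \<le> 1" for x y f g
        using that cr by (intro cut) auto
    qed (use d \<eta> finL finB in \<open>auto simp: A_def P_def B_def\<close>)
    then show ?thesis by simp
  qed
  also have "real (card P) * \<eta> * K \<le> real n ^ 2 * \<eta> * K"
    using cP \<eta> K by (intro mult_right_mono) (auto simp flip: of_nat_power)
  finally have X: "d ^ n\<^sup>2 * (\<delta> ^ r) ^ 2 ^ k * K - real n ^ 2 * \<eta> * K \<le> real (card X)"
    by (simp add: mult_ac)
  \<comment> \<open>Of the \<open>2 * n ^ 2 * \<eta>\<close> in \<open>big\<close>, one half pays
    for the trading error. The other half pays for collisions inside a class: at most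
    \<open>n ^ 2\<close> pairs, each colliding in at most an \<open>\<eta>\<close> share of the maps
    by \<open>size\<close>.\<close>
  define C where "C = {(x, y). x < n \<and> y < n \<and> c x = c y \<and> x \<noteq> y}"
  have subC: "C \<subseteq> {..<n} \<times> {..<n}" unfolding C_def by auto
  then have finC: "finite C" by (rule finite_subset) simp
  have "card C \<le> card ({..<n} \<times> {..<n})" using subC by (intro card_mono) auto
  then have cC: "card C \<le> n ^ 2" by (simp add: power2_eq_square)
  define Y where "Y = (\<Union>(x, y)\<in>C. {\<phi> \<in> PiE {..<n} ?L. \<phi> x = \<phi> y})"
  have "real (card Y) \<le> (\<Sum>(x, y)\<in>C. real (card {\<phi> \<in> PiE {..<n} ?L. \<phi> x = \<phi> y}))"
    unfolding Y_def case_prod_beta of_nat_sum[symmetric] by (intro of_nat_mono card_UN_le finC)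
  also have "\<dots> \<le> (\<Sum>e\<in>C. \<eta> * K)"
    unfolding case_prod_beta
  proof (rule sum_mono)
    fix e assume "e \<in> C"
    then have e: "fst e \<in> {..<n}" "snd e \<in> {..<n}" "fst e \<noteq> snd e" unfolding C_def by auto
    let ?Z = "real (card {\<phi> \<in> PiE {..<n} ?L. \<phi> (fst e) = \<phi> (snd e)})"
    have "?Z * 1 \<le> ?Z * (\<eta> * real (card (?L (fst e))))"
      using size[OF cr] by (intro mult_left_mono) auto
    also have "\<dots> = \<eta> * (?Z * real (card (?L (fst e))))" by simp
    also have "\<dots> \<le> \<eta> * K"
      unfolding K_def using e finL \<eta> by (intro mult_left_mono card_PiE_collision) auto
    finally show "?Z \<le> \<eta> * K" by simp
  qed
  also have "\<dots> = real (card C) * (\<eta> * K)" by simp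
  also have "\<dots> \<le> real n ^ 2 * (\<eta> * K)"
    using cC \<eta> K by (intro mult_right_mono) (auto simp flip: of_nat_power)
  finally have "real (card Y) \<le> real n ^ 2 * \<eta> * K" by simp
  moreover have "2 * real n ^ 2 * \<eta> * K < d ^ n ^ 2 * (\<delta> ^ r) ^ 2 ^ k * K" using big K by simp
  ultimately have "real (card Y) < real (card X)" using X by linarith
  moreover have "finite Y" unfolding Y_def using finC finP by auto
  ultimately have "\<not> X \<subseteq> Y" using card_mono[of Y X] by auto
  then obtain \<phi> where "\<phi> \<in> X" "\<phi> \<notin> Y" by blast
  then show ?thesis
    by (intro exI[of _ \<phi>]) (auto simp: X_def Y_def A_def B_def P_def C_def PiE_def Pi_def)
qed

section \<open>Relabelling hosts, recognising stars, and proper colourings\<close>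

lemma mono_induced_copy_image:
  fixes F :: "'b graph" and f :: "'b \<Rightarrow> 'c"
  assumes F: "is_graph F" and f: "inj_on f (fst F)"
    and mono: "mono_induced_copy F (\<lambda>e. col (f ` e)) b H"
  shows "mono_induced_copy (f ` fst F, (`) f ` snd F) col b H"
proof -
  from mono obtain S where S': "induces_copy F S H"
    and col: "\<And>e. e \<in> snd F \<Longrightarrow> e \<subseteq> S \<Longrightarrow> col (f ` e) = b"
    unfolding mono_induced_copy_def by auto
  from S' have S: "S \<subseteq> fst F" unfolding induces_copy_def by (rule conjunct1)
  from S' obtain g where g: "bij_betw g (fst H) S"
    and ind: "\<And>u v. u \<in> fst H \<Longrightarrow> v \<in> fst H \<Longrightarrow> {u, v} \<in> snd H \<longleftrightarrow> {g u, g v} \<in> snd F"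
    unfolding induces_copy_def by auto
  have sub: "e \<subseteq> fst F" if "e \<in> snd F" for e using F that unfolding is_graph_def by auto
  have img: "f ` e \<in> (`) f ` snd F \<longleftrightarrow> e \<in> snd F" if "e \<subseteq> fst F" for e
  proof
    assume "f ` e \<in> (`) f ` snd F"
    then obtain e' where e': "e' \<in> snd F" "f ` e = f ` e'" by auto
    then show "e \<in> snd F" using inj_on_image_eq_iff[OF f that sub[OF e'(1)]] by simp
  qed simp
  have "bij_betw (f \<circ> g) (fst H) (f ` S)"
    by (rule bij_betw_trans[OF g]) (simp add: bij_betw_def inj_on_subset[OF f S])
  moreover have "{u, v} \<in> snd H \<longleftrightarrow> {(f \<circ> g) u, (f \<circ> g) v} \<in> (`) f ` snd F"
    if "u \<in> fst H" "v \<in> fst H" for u v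
    using ind[OF that] img[of "{g u, g v}"] that g S by (auto simp: bij_betw_def)
  moreover have "col e = b" if e: "e \<in> (`) f ` snd F" "e \<subseteq> f ` S" for e
  proof -
    obtain e' where e': "e' \<in> snd F" "e = f ` e'" using e by auto
    have "e' \<subseteq> S"
    proof
      fix x assume "x \<in> e'"
      then show "x \<in> S" using e(2) e' sub[OF e'(1)] inj_on_image_mem_iff[OF f _ S, of x] by auto
    qed
    then show ?thesis using col e' by blast
  qed
  ultimately show ?thesis
    unfolding mono_induced_copy_def induces_copy_def using S
    by (intro exI[of _ "f ` S"]) auto
qed

text \<open>\<open>IR\<close> only admits hosts on natural numbers. Other hosts are relabelled by an
  injection, and a colouring of the relabelled host is pulled back along it.\<close>

lemma IR_le_card:
  fixes F :: "'b graph"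
  assumes F: "is_graph F" and arr: "ind_arrows F H G"
  shows "IR H G \<le> enat (card (fst F))"
proof -
  have fin: "finite (fst F)" using F unfolding is_graph_def by auto
  from finite_imp_inj_to_nat_seg[OF this]
  obtain f :: "'b \<Rightarrow> nat" where f: "inj_on f (fst F)" by auto
  define F' where "F' = (f ` fst F, (`) f ` snd F)"
  have "is_graph F'"
    unfolding is_graph_def F'_def
  proof (intro conjI ballI)
    fix e assume "e \<in> snd (f ` fst F, (`) f ` snd F)"
    then obtain e' where e': "e' \<in> snd F" "e = f ` e'" by auto
    then have "e' \<subseteq> fst F" "card e' = 2" using F unfolding is_graph_def by auto
    then show "e \<subseteq> fst (f ` fst F, (`) f ` snd F)" "card e = 2"
      using e' card_image[OF inj_on_subset[OF f]] by auto
  qed (use fin in auto)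
  moreover have "ind_arrows F' H G"
    unfolding ind_arrows_def F'_def
  proof
    fix col :: "nat set \<Rightarrow> bool"
    have "mono_induced_copy F (\<lambda>e. col (f ` e)) True H \<or> mono_induced_copy F (\<lambda>e. col (f ` e)) False G"
      using arr unfolding ind_arrows_def by (rule spec)
    then show "mono_induced_copy (f ` fst F, (`) f ` snd F) col True H \<or>
        mono_induced_copy (f ` fst F, (`) f ` snd F) col False G"
      using mono_induced_copy_image[OF F f, of col True H] mono_induced_copy_image[OF F f, of col False G]
      by argo
  qed
  moreover have "card (fst F') = card (fst F)" unfolding F'_def using card_image[OF f] by simp
  ultimately show ?thesis
    unfolding IR_def by (intro Inf_lower CollectI exI[of _ F'] conjI) simp_all
qed

text \<open>Independence of \<open>T\<close> makes the star induced; surplus neighbours are dropped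
  to leave exactly \<open>n\<close> leaves.\<close>

lemma mono_star_copyI:
  fixes F :: "'b graph"
  assumes F: "is_graph F" and u: "u \<in> fst F" and T: "T \<subseteq> fst F" "n \<le> card T"
    and adj: "\<And>a. a \<in> T \<Longrightarrow> {u, a} \<in> snd F \<and> col {u, a} = b"
    and indep: "\<And>a b. a \<in> T \<Longrightarrow> b \<in> T \<Longrightarrow> {a, b} \<notin> snd F"
  shows "mono_induced_copy F col b (star n)"
proof -
  obtain T' where T': "T' \<subseteq> T" "card T' = n" "finite T'"
    using obtain_subset_with_card_n[OF T(2)] by metis
  obtain h where h: "bij_betw h {1..n} T'"
    using ex_bij_betw_nat_finite_1[OF T'(3)] T'(2) by auto
  have c2: "card e = 2" if "e \<in> snd F" for e using F that unfolding is_graph_def by auto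
  have loop: "{x} \<notin> snd F" for x using c2[of "{x}"] by auto
  have uT: "u \<notin> T'" using adj[of u] loop[of u] T' by auto
  define f where "f i = (if i = 0 then u else h i)" for i
  have f: "bij_betw f {0..n} (insert u T')"
  proof -
    have "bij_betw f {1..n} T'" using h by (rule bij_betw_cong[THEN iffD1, rotated]) (auto simp: f_def)
    moreover have "bij_betw f {0} {u}" by (simp add: f_def)
    ultimately have "bij_betw f ({0} \<union> {1..n}) ({u} \<union> T')" using uT by (intro bij_betw_combine) auto
    moreover have "{0} \<union> {1..n} = {0..n}" by auto
    ultimately show ?thesis by simp
  qed
  have fT: "f i \<in> T'" if "i \<in> {1..n}" for i using h that by (auto simp: f_def bij_betw_def)
  have f0: "f 0 = u" by (simp add: f_def)
  have star: "{i, j} \<in> snd (star n) \<longleftrightarrow> (i = 0 \<and> j \<in> {1..n}) \<or> (j = 0 \<and> i \<in> {1..n})" for i j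
    unfolding star_def by (auto simp: doubleton_eq_iff)
  have "{i, j} \<in> snd (star n) \<longleftrightarrow> {f i, f j} \<in> snd F" if ij: "i \<in> {0..n}" "j \<in> {0..n}" for i j
  proof -
    consider "i = 0" "j = 0" | "i = 0" "j \<in> {1..n}" | "i \<in> {1..n}" "j = 0" | "i \<in> {1..n}" "j \<in> {1..n}"
      using ij by (cases "i = 0"; cases "j = 0") auto
    then show ?thesis
    proof cases
      case 1
      then show ?thesis using star[of 0 0] loop[of "f 0"] by simp
    next
      case 2
      then show ?thesis using star[of 0 j] adj[of "f j"] fT[of j] T'(1) f0 by auto
    next
      case 3
      then show ?thesis using star[of i 0] adj[of "f i"] fT[of i] T'(1) f0 by (auto simp: insert_commute)
    next
      case 4
      then show ?thesis using star[of i j] indep[of "f i" "f j"] fT[of i] fT[of j] T'(1) by auto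
    qed
  qed
  moreover have "col e = b" if e: "e \<in> snd F" "e \<subseteq> insert u T'" for e
  proof -
    obtain x y where xy: "e = {x, y}" "x \<noteq> y" using c2[OF e(1)] by (auto simp: card_2_iff)
    then consider "x = u" "y \<in> T" | "x \<in> T" "y = u" | "x \<in> T" "y \<in> T"
      using e(2) T'(1) by auto
    then show ?thesis
    proof cases
      case 1
      then show ?thesis using adj[of y] xy by simp
    next
      case 2
      then show ?thesis using adj[of x] xy by (simp add: insert_commute)
    next
      case 3
      then show ?thesis using indep[of x y] e(1) xy by simp
    qed
  qed
  ultimately show ?thesis
    unfolding mono_induced_copy_def induces_copy_def using f u T T'
    by (intro exI[of _ "insert u T'"]) (auto simp: star_def)
qed

text \<open>An injective numbering of the vertices is a proper colouring, so the minimum defining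
  \<open>chromatic_number\<close> is attained.\<close>

lemma ex_proper_colouring:
  assumes "is_graph H"
  obtains c :: "'a \<Rightarrow> nat" where "\<And>v. v \<in> fst H \<Longrightarrow> c v < chromatic_number H"
    and "\<And>u v. {u, v} \<in> snd H \<Longrightarrow> c u \<noteq> c v"
proof -
  have "finite (fst H)" using assms unfolding is_graph_def by auto
  from finite_imp_inj_to_nat_seg[OF this]
  obtain f :: "'a \<Rightarrow> nat" and n where f: "f ` fst H = {i. i < n}" "inj_on f (fst H)"
    by auto
  have "f u \<noteq> f v" if "{u, v} \<in> snd H" for u v
  proof -
    have "{u, v} \<subseteq> fst H" "card {u, v} = 2" using assms that unfolding is_graph_def by auto
    then show ?thesis using f(2) by (auto simp: inj_on_def card_2_iff doubleton_eq_iff)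
  qed
  then have "\<exists>k. \<exists>c :: 'a \<Rightarrow> nat. (\<forall>v\<in>fst H. c v < k) \<and> (\<forall>u v. {u, v} \<in> snd H \<longrightarrow> c u \<noteq> c v)"
    using f(1) by (intro exI[of _ n] exI[of _ f]) auto
  from LeastI_ex[OF this]
  have "\<exists>c :: 'a \<Rightarrow> nat. (\<forall>v\<in>fst H. c v < chromatic_number H) \<and> (\<forall>u v. {u, v} \<in> snd H \<longrightarrow> c u \<noteq> c v)"
    unfolding chromatic_number_def .
  then show ?thesis using that by auto
qed

section \<open>The blow-up host and its arrowing property\<close>

text \<open>Averaging \<open>f\<close> and \<open>g\<close> over the copies of each base vertex
  yields weights on \<open>U\<close> still bounded by 1. The base bound is thus scaled by
  \<open>\<mu> * \<nu>\<close>.\<close>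

lemma cut_norm_blowup:
  fixes f g :: "'i \<times> 'u \<times> nat \<Rightarrow> real"
  assumes cut: "\<And>f g. (\<And>u. u \<in> U \<Longrightarrow> \<bar>f u\<bar> \<le> 1) \<Longrightarrow> (\<And>u. u \<in> U \<Longrightarrow> \<bar>g u\<bar> \<le> 1) \<Longrightarrow>
       \<bar>\<Sum>u\<in>U. \<Sum>v\<in>U. f u * g v * (of_bool (D u v) - d)\<bar> \<le> \<eta> * real (card U) ^ 2"
    and f: "\<And>u. \<bar>f u\<bar> \<le> 1" and g: "\<And>u. \<bar>g u\<bar> \<le> 1" and pos: "0 < \<mu>" "0 < \<nu>"
  shows "\<bar>\<Sum>u\<in>{i} \<times> U \<times> {..<\<mu>}. \<Sum>v\<in>{j} \<times> U \<times> {..<\<nu>}.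
      f u * g v * (of_bool (D (fst (snd u)) (fst (snd v))) - d)\<bar>
    \<le> \<eta> * real (card ({i} \<times> U \<times> {..<\<mu>})) * real (card ({j} \<times> U \<times> {..<\<nu>}))"
proof -
  define f' where "f' x = (\<Sum>l<\<mu>. f (i, x, l)) / \<mu>" for x
  define g' where "g' x = (\<Sum>l<\<nu>. g (j, x, l)) / \<nu>" for x
  have SP: "(\<Sum>u\<in>{s} \<times> U \<times> L. F u) = (\<Sum>x\<in>U. \<Sum>l\<in>L. F (s, x, l))"
    for s and L :: "nat set" and F :: "'i \<times> 'u \<times> nat \<Rightarrow> real"
  proof -
    have "(\<Sum>u\<in>{s} \<times> U \<times> L. F u) = (\<Sum>s\<in>{s}. \<Sum>x\<in>U. \<Sum>l\<in>L. F (s, x, l))"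
      unfolding sum.cartesian_product by (simp add: case_prod_beta)
    then show ?thesis by simp
  qed
  have f': "\<bar>f' x\<bar> \<le> 1" for x
  proof -
    have "\<bar>\<Sum>l<\<mu>. f (i, x, l)\<bar> \<le> (\<Sum>l<\<mu>. 1)" by (rule order_trans[OF sum_abs sum_mono]) (rule f)
    then show ?thesis using pos by (simp add: f'_def field_simps)
  qed
  have g': "\<bar>g' x\<bar> \<le> 1" for x
  proof -
    have "\<bar>\<Sum>l<\<nu>. g (j, x, l)\<bar> \<le> (\<Sum>l<\<nu>. 1)" by (rule order_trans[OF sum_abs sum_mono]) (rule g)
    then show ?thesis using pos by (simp add: g'_def field_simps)
  qed
  have "(\<Sum>u\<in>{i} \<times> U \<times> {..<\<mu>}. \<Sum>v\<in>{j} \<times> U \<times> {..<\<nu>}. f u * g v * (of_bool (D (fst (snd u)) (fst (snd v))) - d))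
     = (\<Sum>x\<in>U. \<Sum>y\<in>U. (\<Sum>l<\<mu>. f (i, x, l)) * (\<Sum>l<\<nu>. g (j, y, l)) * (of_bool (D x y) - d))"
    unfolding SP
  proof (rule sum.cong[OF refl])
    fix x
    show "(\<Sum>l<\<mu>. \<Sum>y\<in>U. \<Sum>l'<\<nu>. f (i, x, l) * g (j, y, l') * (of_bool (D (fst (snd (i, x, l))) (fst (snd (j, y, l')))) - d))
      = (\<Sum>y\<in>U. (\<Sum>l<\<mu>. f (i, x, l)) * (\<Sum>l<\<nu>. g (j, y, l)) * (of_bool (D x y) - d))"
      unfolding sum_product unfolding sum_distrib_right by (rule trans[OF sum.swap]) (simp only: fst_conv snd_conv)
  qed
  also have "\<dots> = (\<Sum>x\<in>U. \<Sum>y\<in>U. (real \<mu> * real \<nu>) * (f' x * g' y * (of_bool (D x y) - d)))"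
    unfolding f'_def g'_def using pos by (intro sum.cong) auto
  also have "\<dots> = (real \<mu> * real \<nu>) * (\<Sum>x\<in>U. \<Sum>y\<in>U. f' x * g' y * (of_bool (D x y) - d))"
    by (simp add: sum_distrib_left)
  also have "\<bar>\<dots>\<bar> \<le> (real \<mu> * real \<nu>) * (\<eta> * real (card U) ^ 2)"
    using cut[of f' g', OF f' g'] by (simp add: abs_mult mult_left_mono)
  finally show ?thesis by (simp add: card_cartesian_product power2_eq_square mult_ac)
qed

text \<open>This serves the case of chromatic number at most 1: without edges, \<open>H\<close> is
  vacuously red in itself.\<close>

lemma ind_arrows_edgeless:
  assumes "snd H = {}"
  shows "ind_arrows H H G"
proof -
  have "mono_induced_copy H col True H" for col
    unfolding mono_induced_copy_def induces_copy_def
    using assms by (intro exI[of _ "fst H"] conjI exI[of _ id]) auto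
  then show ?thesis unfolding ind_arrows_def by simp
qed

text \<open>A vertex \<open>(s, x, l)\<close> is the l-th copy of x in part s. The relation D describes the non-edges.\<close>
definition blowup_graph :: "'u set \<Rightarrow> ('u \<Rightarrow> 'u \<Rightarrow> bool) \<Rightarrow> nat \<Rightarrow> (nat \<Rightarrow> nat) \<Rightarrow> (nat \<times> 'u \<times> nat) graph" where
  "blowup_graph U D r \<mu> =
    (\<Union>s<r. {s} \<times> U \<times> {..<\<mu> s},
     {{u, v} | u v. u \<in> (\<Union>s<r. {s} \<times> U \<times> {..<\<mu> s}) \<and> v \<in> (\<Union>s<r. {s} \<times> U \<times> {..<\<mu> s}) \<and>
        fst u < fst v \<and> \<not> D (fst (snd u)) (fst (snd v))})"

lemma is_graph_blowup_graph: "finite U \<Longrightarrow> is_graph (blowup_graph U D r \<mu>)"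
  unfolding is_graph_def blowup_graph_def by (fastforce simp: card_2_iff)

lemma edge_blowup_graph:
  assumes "u \<in> fst (blowup_graph U D r \<mu>)" "v \<in> fst (blowup_graph U D r \<mu>)" "fst u \<le> fst v"
  shows "{u, v} \<in> snd (blowup_graph U D r \<mu>) \<longleftrightarrow> fst u < fst v \<and> \<not> D (fst (snd u)) (fst (snd v))"
proof
  assume "{u, v} \<in> snd (blowup_graph U D r \<mu>)"
  then obtain u' v' where uv: "{u, v} = {u', v'}" "fst u' < fst v'" "\<not> D (fst (snd u')) (fst (snd v'))"
    unfolding blowup_graph_def snd_conv by blast
  with assms(3) have "u = u'" "v = v'" by (auto simp: doubleton_eq_iff)
  with uv show "fst u < fst v \<and> \<not> D (fst (snd u)) (fst (snd v))" by simp
next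
  assume "fst u < fst v \<and> \<not> D (fst (snd u)) (fst (snd v))"
  with assms show "{u, v} \<in> snd (blowup_graph U D r \<mu>)"
    unfolding blowup_graph_def fst_conv snd_conv by blast
qed

text \<open>Without a blue star, blue neighbours fill at most an \<open>\<alpha>\<close> share of a
  later part and non-neighbours a \<open>d\<close> share, so \<open>induced_blowup_embedding\<close>
  applies with \<open>\<beta> = \<alpha> + d\<close>. Only parts after the first need to be large,
  since degrees are measured towards higher parts.\<close>

lemma blowup_graph_arrows_star:
  fixes H :: "'a graph" and col :: "'a \<Rightarrow> nat" and \<mu> :: "nat \<Rightarrow> nat" and U :: "'u set"
  assumes H: "is_graph H" and r: "r > 0"
    and col_less: "\<And>v. v \<in> fst H \<Longrightarrow> col v < r"
    and proper: "\<And>u v. {u, v} \<in> snd H \<Longrightarrow> col u \<noteq> col v"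
    and U: "finite U" "U \<noteq> {}" "1 \<le> \<eta> * real (card U)"
    and dens: "\<And>u. u \<in> U \<Longrightarrow> real (card {v \<in> U. D u v}) = d * real (card U)"
    and cut: "\<And>f g. (\<And>u. u \<in> U \<Longrightarrow> \<bar>f u\<bar> \<le> 1) \<Longrightarrow> (\<And>u. u \<in> U \<Longrightarrow> \<bar>g u\<bar> \<le> 1) \<Longrightarrow>
       \<bar>\<Sum>u\<in>U. \<Sum>v\<in>U. f u * g v * (of_bool (D u v) - d)\<bar> \<le> \<eta> * real (card U) ^ 2"
    and \<mu>: "\<And>s. s < r \<Longrightarrow> 0 < \<mu> s"
    and d: "0 \<le> d" "d \<le> 1" and \<eta>: "0 \<le> \<eta>" and \<alpha>: "0 \<le> \<alpha>"
    and large: "\<And>s. 0 < s \<Longrightarrow> s < r \<Longrightarrow> real n \<le> \<alpha> * real (card U * \<mu> s)"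
    and \<delta>: "0 \<le> \<delta>" "\<delta> \<le> 1 - (real r - 1) * (\<alpha> + d)"
    and big: "2 * real (r + card (fst H)) ^ 2 * \<eta> < d ^ (r + card (fst H)) ^ 2 * (\<delta> ^ r) ^ 2 ^ card (fst H)"
  shows "ind_arrows (blowup_graph U D r \<mu>) H (star n)"
  unfolding ind_arrows_def
proof (intro allI disjCI)
  define F where "F = blowup_graph U D r \<mu>"
  define W where "W s = {s} \<times> U \<times> {..<\<mu> s}" for s
  fix cl :: "(nat \<times> 'u \<times> nat) set \<Rightarrow> bool"
  assume "\<not> mono_induced_copy (blowup_graph U D r \<mu>) cl False (star n)"
  then have nostar: "\<not> mono_induced_copy F cl False (star n)" unfolding F_def .
  define R where "R u v \<longleftrightarrow> {u, v} \<in> snd F \<and> cl {u, v}" for u v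
  define D' where "D' u v \<longleftrightarrow> D (fst (snd u)) (fst (snd v))" for u v :: "nat \<times> 'u \<times> nat"
  define k where "k = card (fst H)"
  have F: "is_graph F" unfolding F_def by (rule is_graph_blowup_graph[OF U(1)])
  have WF: "W s \<subseteq> fst F" if "s < r" for s using that unfolding W_def F_def blowup_graph_def by auto
  have Wfst: "fst u = s" if "u \<in> W s" for u s using that unfolding W_def by auto
  have edge: "{u, v} \<in> snd F \<longleftrightarrow> i < j \<and> \<not> D' u v"
    if "u \<in> W i" "v \<in> W j" "i \<le> j" "j < r" for u v i j
  proof -
    have "u \<in> fst F" "v \<in> fst F" using WF[of i] WF[of j] that by auto
    then show ?thesis
      using edge_blowup_graph[of u U D r \<mu> v] that Wfst unfolding F_def D'_def by auto
  qed
  have finW: "finite (W s)" and cW: "card (W s) = card U * \<mu> s" for s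
    using U unfolding W_def by (auto simp: card_cartesian_product)
  have deg: "real (card {a \<in> W j. \<not> R v a}) \<le> (\<alpha> + d) * real (card (W j))"
    if "i < j" "j < r" "v \<in> W i" for i j v
  proof -
    define T where "T = {a \<in> W j. {v, a} \<in> snd F \<and> \<not> cl {v, a}}"
    have vU: "fst (snd v) \<in> U" using that unfolding W_def by auto
    have "{a \<in> W j. D' v a} = {j} \<times> {y \<in> U. D (fst (snd v)) y} \<times> {..<\<mu> j}"
      unfolding W_def D'_def by auto
    then have c1: "real (card {a \<in> W j. D' v a}) = d * real (card (W j))"
      using dens[OF vU] by (simp add: card_cartesian_product cW)
    \<comment> \<open>\<open>T\<close> lies inside a single part and is therefore independent, so
      \<open>n\<close> vertices of it would be the leaves of a blue induced star at
      \<open>v\<close>.\<close>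
    have "card T < n"
    proof (rule ccontr)
      assume "\<not> card T < n"
      then have "mono_induced_copy F cl False (star n)"
        using that WF[of i] WF[of j] edge[of _ j _ j]
        by (intro mono_star_copyI[OF F, of v T]) (auto simp: T_def)
      then show False using nostar by simp
    qed
    then have c2: "real (card T) \<le> \<alpha> * real (card (W j))" using large[of j] that by (simp add: cW)
    have "{a \<in> W j. \<not> R v a} \<subseteq> T \<union> {a \<in> W j. D' v a}"
      using edge[OF that(3), of _ j] that unfolding R_def T_def by auto
    then have "card {a \<in> W j. \<not> R v a} \<le> card (T \<union> {a \<in> W j. D' v a})"
      using finW by (intro card_mono) (auto simp: T_def)
    also have "\<dots> \<le> card T + card {a \<in> W j. D' v a}" by (rule card_Un_le)
    finally have "real (card {a \<in> W j. \<not> R v a}) \<le> real (card T) + real (card {a \<in> W j. D' v a})"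
      by linarith
    then show ?thesis using c1 c2 by (simp add: algebra_simps)
  qed
  have fH: "finite (fst H)" using H unfolding is_graph_def by auto
  obtain h where h: "bij_betw h {0..<k} (fst H)"
    using ex_bij_betw_nat_finite[OF fH] unfolding k_def by blast
  define h' where "h' = inv_into {0..<k} h"
  have h'k: "h' v < k" and hh': "h (h' v) = v" if "v \<in> fst H" for v
    using that h bij_betw_inv_into[OF h] bij_betw_inv_into_right[OF h] unfolding h'_def
    by (auto simp: bij_betw_def)
  \<comment> \<open>Indices below \<open>r\<close> form the transversal, and index
    \<open>r + j\<close> stands for the vertex \<open>h j\<close> of \<open>H\<close>. The final
    default 0 keeps \<open>c i < r\<close> for every index.\<close>
  define c where "c i = (if i < r then i else if i < r + k then col (h (i - r)) else 0)" for i
  have c: "c s = s" if "s < r" for s using that by (simp add: c_def)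
  have cr: "c i < r" for i
  proof -
    have "h (i - r) \<in> fst H" if "\<not> i < r" "i < r + k"
      using h that by (auto simp: bij_betw_def)
    then show ?thesis using r col_less unfolding c_def by auto
  qed
  have cidx: "c (r + h' v) = col v" if "v \<in> fst H" for v
    using h'k[OF that] hh'[OF that] by (simp add: c_def)
  \<comment> \<open>For indices below \<open>r\<close> the truncated subtraction gives meaningless
    entries. They are harmless, as the copy of \<open>H\<close> is read off from indices
    \<open>r\<close> onwards.\<close>
  define N where "N = {(x, y). {h (x - r), h (y - r)} \<notin> snd H}"
  have neW: "W s \<noteq> {}" if "s < r" for s
    using U \<mu>[OF that] unfolding W_def by (auto simp: lessThan_empty_iff)
  have sz: "1 \<le> \<eta> * real (card (W s))" if "s < r" for s
  proof -
    have "\<eta> * real (card U) * 1 \<le> \<eta> * real (card U) * real (\<mu> s)"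
      using \<mu>[OF that] \<eta> by (intro mult_left_mono) auto
    then show ?thesis using U(3) by (simp add: cW mult_ac)
  qed
  have cut': "\<bar>\<Sum>u\<in>W i. \<Sum>v\<in>W j. f u * g v * (of_bool (D' u v) - d)\<bar>
      \<le> \<eta> * real (card (W i)) * real (card (W j))"
    if "i < j" "j < r" "\<And>u. \<bar>f u\<bar> \<le> 1" "\<And>v. \<bar>g v\<bar> \<le> 1" for i j f g
    unfolding W_def D'_def by (rule cut_norm_blowup[OF cut]) (use that \<mu> in auto)
  have \<beta>: "0 \<le> \<alpha> + d" using \<alpha> d by simp
  have "\<exists>\<phi>. (\<forall>x<r + k. \<phi> x \<in> W (c x)) \<and>
    (\<forall>x<r + k. \<forall>y<r + k. c x < c y \<longrightarrow> (if (x, y) \<in> N then D' (\<phi> x) (\<phi> y) else R (\<phi> x) (\<phi> y))) \<and>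
    (\<forall>x<r + k. \<forall>y<r + k. c x = c y \<longrightarrow> x \<noteq> y \<longrightarrow> \<phi> x \<noteq> \<phi> y)"
  proof (rule induced_blowup_embedding[where r = r and k = k])
    show "\<bar>\<Sum>u\<in>W i. \<Sum>v\<in>W j. f u * g v * (of_bool (D' u v) - d)\<bar>
        \<le> \<eta> * real (card (W i)) * real (card (W j))"
      if "i < j" "j < r" "\<And>u. \<bar>f u\<bar> \<le> 1" "\<And>v. \<bar>g v\<bar> \<le> 1" for i j f g
      by (rule cut'[OF that])
    show "2 * real (r + k) ^ 2 * \<eta> < d ^ (r + k) ^ 2 * (\<delta> ^ r) ^ 2 ^ k" using big unfolding k_def .
    show "real (card {a \<in> W j. \<not> R v a}) \<le> (\<alpha> + d) * real (card (W j))"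
      if "i < j" "j < r" "v \<in> W i" for i j v by (rule deg[OF that])
  qed (rule refl finW neW c cr \<delta> \<beta> sz d \<eta>; assumption)+
  then obtain \<phi> where \<phi>: "\<forall>x<r + k. \<phi> x \<in> W (c x)"
    "\<forall>x<r + k. \<forall>y<r + k. c x < c y \<longrightarrow> (if (x, y) \<in> N then D' (\<phi> x) (\<phi> y) else R (\<phi> x) (\<phi> y))"
    "\<forall>x<r + k. \<forall>y<r + k. c x = c y \<longrightarrow> x \<noteq> y \<longrightarrow> \<phi> x \<noteq> \<phi> y"
    by (elim exE conjE)
  define g where "g v = \<phi> (r + h' v)" for v
  have gW: "g v \<in> W (col v)" if "v \<in> fst H" for v
    using \<phi>(1)[rule_format, of "r + h' v"] h'k[OF that] cidx[OF that] unfolding g_def by simp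
  have main: "({u, v} \<in> snd H \<longleftrightarrow> {g u, g v} \<in> snd F) \<and> ({g u, g v} \<in> snd F \<longrightarrow> cl {g u, g v})"
    if uv: "u \<in> fst H" "v \<in> fst H" "col u < col v" for u v
  proof -
    have lt: "r + h' u < r + k" "r + h' v < r + k" "c (r + h' u) < c (r + h' v)"
      using h'k uv cidx by auto
    have N: "(r + h' u, r + h' v) \<in> N \<longleftrightarrow> {u, v} \<notin> snd H" using hh' uv unfolding N_def by simp
    show ?thesis
    proof (cases "{u, v} \<in> snd H")
      case True
      then show ?thesis using \<phi>(2)[rule_format, OF lt] N unfolding R_def g_def by simp
    next
      case False
      then have "D' (g u) (g v)" using \<phi>(2)[rule_format, OF lt] N unfolding g_def by simp
      then show ?thesis using edge[OF gW[OF uv(1)] gW[OF uv(2)]] uv(3) col_less[OF uv(2)] False by simp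
    qed
  qed
  have same: "{u, v} \<notin> snd H \<and> {g u, g v} \<notin> snd F"
    if uv: "u \<in> fst H" "v \<in> fst H" "col u = col v" for u v
    using proper[of u v] edge[OF gW[OF uv(1)] gW[OF uv(2)]] uv(3) col_less[OF uv(2)] by auto
  have full: "({u, v} \<in> snd H \<longleftrightarrow> {g u, g v} \<in> snd F) \<and> ({g u, g v} \<in> snd F \<longrightarrow> cl {g u, g v})"
    if uv: "u \<in> fst H" "v \<in> fst H" for u v
  proof -
    consider "col u < col v" | "col v < col u" | "col u = col v" by linarith
    then show ?thesis
    proof cases
      case 1
      then show ?thesis by (rule main[OF uv])
    next
      case 2
      then show ?thesis using main[OF uv(2,1)] by (simp add: insert_commute)
    next
      case 3
      then show ?thesis using same[OF uv] by simp
    qed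
  qed
  have inj: "inj_on g (fst H)"
  proof (rule inj_onI)
    fix u v assume uv: "u \<in> fst H" "v \<in> fst H" "g u = g v"
    then have "col u = col v" using gW Wfst by metis
    then have "r + h' u = r + h' v"
      using \<phi>(3)[rule_format, of "r + h' u" "r + h' v"] h'k uv cidx unfolding g_def by auto
    then show "u = v" using hh' uv by (metis add_left_cancel)
  qed
  have "cl e" if e: "e \<in> snd F" "e \<subseteq> g ` fst H" for e
  proof -
    have "card e = 2" using F e unfolding is_graph_def by auto
    then obtain x y where "e = {x, y}" by (auto simp: card_2_iff)
    then show ?thesis using e full by auto
  qed
  moreover have "g ` fst H \<subseteq> fst F" using gW WF col_less by blast
  ultimately show "mono_induced_copy (blowup_graph U D r \<mu>) cl True H"
    unfolding F_def[symmetric] mono_induced_copy_def induces_copy_def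
    using inj full by (intro exI[of _ "g ` fst H"] conjI exI[of _ g]) (auto simp: bij_betw_def)
qed

lemma card_blowup_graph_le:
  assumes "r > 0"
  shows "card (fst (blowup_graph U D r (\<lambda>s. if s = 0 then 1 else m))) \<le> card U + (r - 1) * (card U * m)"
proof -
  let ?\<mu> = "\<lambda>s :: nat. if s = 0 then 1 else m"
  have "card (fst (blowup_graph U D r ?\<mu>)) \<le> (\<Sum>s<r. card ({s} \<times> U \<times> {..<?\<mu> s}))"
    unfolding blowup_graph_def fst_conv by (rule card_UN_le) simp
  also have "\<dots> = (\<Sum>s<Suc (r - 1). card U * ?\<mu> s)"
    using assms by (simp add: card_cartesian_product)
  also have "\<dots> = card U + (r - 1) * (card U * m)"
    by (simp only: sum.lessThan_Suc_shift) simp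
  finally show ?thesis .
qed

section \<open>Choice of constants and the vertex count\<close>

theorem theorem2:
  fixes H :: "'a graph" and \<gamma> :: real and r :: nat
  assumes "is_graph H" and "\<gamma> > 0" and "chromatic_number H = r"
  shows "\<exists>n0::nat. \<forall>n>n0.
           IR H (star n) \<le> enat (nat \<lfloor>(real r - 1)^2 * real n + \<gamma> * real n\<rfloor>)"
proof -
  note H = \<open>is_graph H\<close> and \<gamma> = \<open>\<gamma> > 0\<close>
  obtain col :: "'a \<Rightarrow> nat" where col: "\<And>v. v \<in> fst H \<Longrightarrow> col v < r"
    and proper: "\<And>u v. {u, v} \<in> snd H \<Longrightarrow> col u \<noteq> col v"
    using ex_proper_colouring[OF H] assms(3) by blast
  define k where "k = card (fst H)"
  show ?thesis
  proof (cases "r \<le> 1")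
    case True
    have "snd H = {}"
    proof (rule ccontr)
      assume "snd H \<noteq> {}"
      then obtain e where e: "e \<in> snd H" by blast
      then have "e \<subseteq> fst H" "card e = 2" using H unfolding is_graph_def by auto
      then obtain u v where "e = {u, v}" "u \<in> fst H" "v \<in> fst H" by (auto simp: card_2_iff)
      then show False using proper[of u v] col[of u] col[of v] e True by simp
    qed
    have IR: "IR H (star n) \<le> enat k" for n
      unfolding k_def by (intro IR_le_card H ind_arrows_edgeless \<open>snd H = {}\<close>)
    show ?thesis
    proof (intro exI allI impI)
      fix n assume n: "n > nat \<lceil>real k / \<gamma>\<rceil>"
      then have "real k / \<gamma> \<le> real n" by linarith
      then have "real k \<le> \<gamma> * real n" using \<gamma> by (simp add: field_simps)
      then have "real k \<le> (real r - 1)^2 * real n + \<gamma> * real n" by (simp add: add_increasing)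
      then have "k \<le> nat \<lfloor>(real r - 1)^2 * real n + \<gamma> * real n\<rfloor>" by linarith
      then show "IR H (star n) \<le> enat (nat \<lfloor>(real r - 1)^2 * real n + \<gamma> * real n\<rfloor>)"
        using IR[of n] by (meson enat_ord_simps(1) order_trans)
    qed
  next
    case False
    define t where "t = real r - 1"
    have t: "t \<ge> 1" using False unfolding t_def by linarith
    \<comment> \<open>Each of the \<open>t\<close> large parts will have about
      \<open>(t + \<rho>) * n\<close> vertices, so the excess over \<open>t ^ 2 * n\<close> is
      \<open>t * \<rho> * n = \<gamma> / 2 * n\<close>. Fewer than \<open>n\<close> blue neighbours
      are then at most an \<open>\<alpha>\<close> share. Of the remaining
      \<open>1 - t * \<alpha> = 2 * \<delta>\<close>, one half, \<open>t * \<epsilon>\<close>, is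
      reserved for non-edges and the other is the surviving share \<open>\<delta>\<close>.\<close>
    define \<rho> where "\<rho> = \<gamma> / (2 * t)"
    have \<rho>: "\<rho> > 0" using t \<gamma> unfolding \<rho>_def by simp
    define \<epsilon> where "\<epsilon> = \<rho> / (2 * t * (t + \<rho>))"
    define \<alpha> where "\<alpha> = 1 / (t + \<rho>)"
    define \<delta> where "\<delta> = \<rho> / (2 * (t + \<rho>))"
    have nz: "t \<noteq> 0" "t + \<rho> \<noteq> 0" using t \<rho> by auto
    have \<delta>: "\<delta> > 0" and \<alpha>: "\<alpha> \<ge> 0" using t \<rho> unfolding \<delta>_def \<alpha>_def by auto
    have t\<epsilon>: "t * \<epsilon> = \<delta>" using nz unfolding \<epsilon>_def \<delta>_def by simp
    have "\<delta> < 1" using t \<rho> unfolding \<delta>_def by (simp add: field_simps)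
    moreover have \<epsilon>0: "\<epsilon> > 0" using t \<rho> unfolding \<epsilon>_def by simp
    moreover have "\<epsilon> * 1 \<le> \<epsilon> * t" using t \<epsilon>0 by (intro mult_left_mono) auto
    ultimately have \<epsilon>: "0 < \<epsilon>" "\<epsilon> < 1" using t\<epsilon> by (linarith, argo)
    have "2 * \<delta> = \<rho> / (t + \<rho>)" using mult_divide_mult_cancel_left[of 2 \<rho> "t + \<rho>"] unfolding \<delta>_def by simp
    then have "t * \<alpha> + 2 * \<delta> = 1" using nz unfolding \<alpha>_def by (simp flip: add_divide_distrib)
    define K where "K = r + k"
    have K: "real K > 0" using False unfolding K_def by simp
    \<comment> \<open>\<open>\<theta>\<close> uses \<open>\<epsilon> / 2\<close> in place of
      \<open>d\<close>, because \<open>\<eta>\<close> has to be fixed before the base graph and its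
      density are obtained. The 4 in \<open>\<eta>\<close> makes \<open>2 * K ^ 2 * \<eta>\<close>
      equal to \<open>\<theta> / 2\<close>, which gives strict inequality.\<close>
    define \<theta> where "\<theta> = (\<epsilon> / 2) ^ K ^ 2 * (\<delta> ^ r) ^ 2 ^ k"
    have \<theta>: "\<theta> > 0" using \<epsilon> \<delta> unfolding \<theta>_def by simp
    define \<eta> where "\<eta> = \<theta> / (4 * real K ^ 2)"
    have \<eta>: "\<eta> > 0" using \<theta> K unfolding \<eta>_def by simp
    obtain U :: "(int \<times> int) set" and D d where U: "finite U" "U \<noteq> {}" "1 \<le> \<eta> * real (card U)"
      and d: "\<epsilon> / 2 \<le> d" "d \<le> \<epsilon>"
      and dens: "\<forall>u\<in>U. real (card {v \<in> U. D u v}) = d * real (card U)"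
      and cut: "\<forall>f g. (\<forall>u\<in>U. \<bar>f u\<bar> \<le> 1) \<longrightarrow> (\<forall>u\<in>U. \<bar>g u\<bar> \<le> 1) \<longrightarrow>
         \<bar>\<Sum>u\<in>U. \<Sum>v\<in>U. f u * g v * (of_bool (D u v) - d)\<bar> \<le> \<eta> * real (card U) ^ 2"
      using quasirandom_bipartite_graph[OF \<epsilon> \<eta>] by (elim exE conjE)
    define N where "N = real (card U)"
    have N: "N > 0" using U unfolding N_def by (simp add: card_gt_0_iff)
    have d01: "0 \<le> d" "d \<le> 1" using d \<epsilon> by auto
    have "t * d \<le> t * \<epsilon>" using t d by (intro mult_left_mono) auto
    then have \<delta>': "\<delta> \<le> 1 - (real r - 1) * (\<alpha> + d)"
      using t\<epsilon> \<open>t * \<alpha> + 2 * \<delta> = 1\<close> unfolding t_def[symmetric] by (simp add: algebra_simps)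
    have "2 * real K ^ 2 * \<eta> = \<theta> / 2" using K unfolding \<eta>_def by simp
    also have "\<dots> < \<theta>" using \<theta> by simp
    also have "\<dots> \<le> d ^ K ^ 2 * (\<delta> ^ r) ^ 2 ^ k"
      unfolding \<theta>_def using d \<epsilon> \<delta> by (intro mult_right_mono power_mono) auto
    finally have big: "2 * real K ^ 2 * \<eta> < d ^ K ^ 2 * (\<delta> ^ r) ^ 2 ^ k" .
    show ?thesis
    proof (intro exI allI impI)
      \<comment> \<open>The threshold lets the other \<open>\<gamma> / 2 * n\<close> absorb
        \<open>(1 + t) * N\<close>: the small part of size \<open>N\<close>, and a rounding loss of
        at most \<open>N\<close> in each of the \<open>t\<close> large parts.\<close>
      fix n assume n: "n > nat \<lceil>2 * (1 + t) * N / \<gamma>\<rceil>"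
      then have "2 * (1 + t) * N / \<gamma> \<le> real n" by linarith
      then have n_ge: "(1 + t) * N \<le> \<gamma> / 2 * real n" using \<gamma> by (simp add: field_simps)
      have n0: "n > 0" using n by simp
      define m where "m = nat \<lceil>(t + \<rho>) * real n / N\<rceil>"
      \<comment> \<open>A single copy suffices in part 0, where the greedy choice starts
        unrestricted. This leaves only \<open>r - 1\<close> large parts, hence the square of
        \<open>r - 1\<close> in the bound.\<close>
      define \<mu> where "\<mu> s = (if s = 0 then 1 else m)" for s :: nat
      have x0: "(t + \<rho>) * real n / N > 0" using t \<rho> N n0 by simp
      have m: "(t + \<rho>) * real n / N \<le> real m" "real m \<le> (t + \<rho>) * real n / N + 1"
        using x0 unfolding m_def by linarith+
      have "m > 0" using m(1) x0 by linarith
      have m1: "(t + \<rho>) * real n \<le> N * real m" and m2: "N * real m \<le> (t + \<rho>) * real n + N"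
        using m N by (auto simp: field_simps)
      define F where "F = blowup_graph U D r \<mu>"
      have "ind_arrows F H (star n)"
        unfolding F_def
      proof (rule blowup_graph_arrows_star[where \<eta> = \<eta> and d = d and \<alpha> = \<alpha> and \<delta> = \<delta>, OF H _ col proper U dens[rule_format] cut[rule_format]])
        show "0 < \<mu> s" for s using \<open>m > 0\<close> by (simp add: \<mu>_def)
        show "real n \<le> \<alpha> * real (card U * \<mu> s)" if "0 < s" for s
          using m1 that t \<rho> unfolding \<alpha>_def \<mu>_def N_def by (simp add: field_simps)
        show "2 * real (r + card (fst H)) ^ 2 * \<eta>
            < d ^ (r + card (fst H)) ^ 2 * (\<delta> ^ r) ^ 2 ^ card (fst H)"
          using big unfolding K_def k_def .
      qed (use False d01 \<eta> \<alpha> \<delta> \<delta>' in auto)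
      then have IR: "IR H (star n) \<le> enat (card (fst F))"
        by (intro IR_le_card) (simp_all add: F_def is_graph_blowup_graph U)
      have "card (fst F) \<le> card U + (r - 1) * (card U * m)"
        unfolding F_def \<mu>_def using False by (intro card_blowup_graph_le) simp
      then have "real (card (fst F)) \<le> real (card U + (r - 1) * (card U * m))" by (rule of_nat_mono)
      also have "\<dots> = N + t * (N * real m)"
        using False unfolding N_def t_def by (simp add: of_nat_diff)
      also have "\<dots> \<le> N + t * ((t + \<rho>) * real n + N)"
        using m2 t by (intro add_left_mono mult_left_mono) auto
      also have "\<dots> = t ^ 2 * real n + (t * \<rho>) * real n + (1 + t) * N"
        by (simp add: algebra_simps power2_eq_square)
      also have "t * \<rho> = \<gamma> / 2" using t unfolding \<rho>_def by simp
      also have "t ^ 2 * real n + \<gamma> / 2 * real n + (1 + t) * N \<le> t ^ 2 * real n + \<gamma> * real n"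
        using n_ge by simp
      finally have "card (fst F) \<le> nat \<lfloor>(real r - 1)^2 * real n + \<gamma> * real n\<rfloor>"
        unfolding t_def by linarith
      then show "IR H (star n) \<le> enat (nat \<lfloor>(real r - 1)^2 * real n + \<gamma> * real n\<rfloor>)"
        using IR by (meson enat_ord_simps(1) order_trans)
    qed
  qed
qed

end
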